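(* For each $n\ge 3$ let $\bm\mu=\bm\mu^{(n)}=(\mu_1,\dots,\mu_n)$ be a vector of positive reals (the entries may depend on $n$), and let $T_n$ be the number of triangles in the $\beta$-model on $n$ vertices with parameter vector $\bm\mu$, i.e. with independent edges of probabilities $p_{ij}=\mu_i\mu_j/(1+\mu_i\mu_j)$. Let $F_n=(T_n-\mathbb{E}[T_n])/\sqrt{\mathrm{Var}[T_n]}$. Suppose that, as $n\to\infty$, $\mu_{\max}\to 0$ and $\|\bm\mu\|_2\to\infty$, and that at least one of the following two conditions holds as $n\to\infty$: (i) $\|\bm\mu\|_{3/2}^{3/2}=O\big(\|\bm\mu\|_2^6\big)$; (ii) $\dfrac{\mu_{\max}}{\mu_{\min}}=O\big(\|\bm\mu\|_2^{3/2}\big)$. Then $F_n$ converges in distribution to a standard normal random variable as $n\to\infty$.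
   Context: The $\beta$-model on vertex set $[n]=\{1,\dots,n\}$ with parameters $\beta_1,\dots,\beta_n\in\mathbb{R}$ (possibly depending on $n$) is the random simple undirected graph in which, for each pair $i\ne j$, the edge $\{i,j\}$ is present with probability $p_{ij}=e^{\beta_i+\beta_j}/(1+e^{\beta_i+\beta_j})$, independently over unordered pairs. Writing $\mu_i=e^{\beta_i}>0$, we have $p_{ij}=\mu_i\mu_j/(1+\mu_i\mu_j)$. Let $I_{ij}=I_{ji}$ be the indicator that the edge $\{i,j\}$ is present. The number of triangles is $T_n=\sum_{1\le i<j<k\le n}I_{ij}I_{jk}I_{ki}$. For a vector $\bm x\in\mathbb{R}^n$ and $s>0$, $\|\bm x\|_s=(\sum_{i=1}^n|x_i|^s)^{1/s}$, and $x_{\max}$, $x_{\min}$ are the maximal and minimal entries of $\bm x$. *)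

theory Defs
  imports "HOL-Probability.Probability" "HOL-Library.Landau_Symbols"
begin

text \<open>
  A vector \<open>x\<close> in \<open>R^n\<close> is a function on \<^typ>\<open>nat\<close> of which only the entries with index in
  \<open>{1..n}\<close> are used.
\<close>

definition lp_norm :: "real \<Rightarrow> nat \<Rightarrow> (nat \<Rightarrow> real) \<Rightarrow> real" where
  "lp_norm s n x = (\<Sum>i=1..n. \<bar>x i\<bar> powr s) powr (1 / s)"

definition vec_max :: "nat \<Rightarrow> (nat \<Rightarrow> real) \<Rightarrow> real" where
  "vec_max n x = Max (x ` {1..n})"

definition vec_min :: "nat \<Rightarrow> (nat \<Rightarrow> real) \<Rightarrow> real" where
  "vec_min n x = Min (x ` {1..n})"

text \<open>
  An edge is a two-element set of vertices, and a graph is the indicator function of its edge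
  set. The parameters are \<open>\<mu> i = exp (\<beta> i)\<close>; the product over the two endpoints of the edge
  is the usual \<open>\<mu> i * \<mu> j\<close> (see the two lemmas below).
\<close>

definition edge_prob :: "(nat \<Rightarrow> real) \<Rightarrow> nat set \<Rightarrow> real" where
  "edge_prob \<mu> e = (\<Prod>v\<in>e. \<mu> v) / (1 + (\<Prod>v\<in>e. \<mu> v))"

lemma edge_prob_doubleton:
  "i \<noteq> j \<Longrightarrow> edge_prob \<mu> {i, j} = \<mu> i * \<mu> j / (1 + \<mu> i * \<mu> j)"
  by (simp add: edge_prob_def)

lemma edge_prob_exp:
  "i \<noteq> j \<Longrightarrow> edge_prob (\<lambda>v. exp (\<beta> v)) {i, j} = exp (\<beta> i + \<beta> j) / (1 + exp (\<beta> i + \<beta> j))"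
  by (simp add: edge_prob_doubleton exp_add)

definition vertex_pairs :: "nat \<Rightarrow> nat set set" where
  "vertex_pairs n = {e. e \<subseteq> {1..n} \<and> card e = 2}"

definition beta_model :: "nat \<Rightarrow> (nat \<Rightarrow> real) \<Rightarrow> (nat set \<Rightarrow> bool) pmf" where
  "beta_model n \<mu> = Pi_pmf (vertex_pairs n) False (\<lambda>e. bernoulli_pmf (edge_prob \<mu> e))"

definition edge_ind :: "(nat set \<Rightarrow> bool) \<Rightarrow> nat \<Rightarrow> nat \<Rightarrow> real" where
  "edge_ind G i j = of_bool (G {i, j})"

definition num_triangles :: "nat \<Rightarrow> (nat set \<Rightarrow> bool) \<Rightarrow> real" where
  "num_triangles n G =
     (\<Sum>i\<in>{1..n}. \<Sum>j\<in>{i<..n}. \<Sum>k\<in>{j<..n}. edge_ind G i j * edge_ind G j k * edge_ind G k i)"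

definition normalized_triangles :: "nat \<Rightarrow> (nat \<Rightarrow> real) \<Rightarrow> (nat set \<Rightarrow> bool) \<Rightarrow> real" where
  "normalized_triangles n \<mu> G =
     (num_triangles n G - measure_pmf.expectation (beta_model n \<mu>) (num_triangles n)) /
     sqrt (measure_pmf.variance (beta_model n \<mu>) (num_triangles n))"

end

theory Submission
  imports Defs
begin

text \<open>
  Let \<open>W\<close> be the centred triangle count, \<open>\<sigma>\<^sup>2\<close> its variance and \<open>\<phi>\<close> the characteristic
  function of \<open>W / \<sigma>\<close>. As two triangles are dependent only if they share an edge, Stein's local
  dependence argument, applied to the test functions \<open>exp (i t x)\<close> (Tikhomirov's method), gives
  \<open>\<phi>' t = - t \<phi> t + O(t\<^sup>2 \<delta>)\<close>, hence \<open>\<phi> t = exp (- t\<^sup>2 / 2) + O(\<bar>t\<bar>\<^sup>3 \<delta>)\<close>. Here \<open>\<sigma>\<^sup>3 \<delta>\<close> is, up to a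
  constant factor, the sum of the probabilities that three triangles \<open>a, b, c\<close> are all present, where \<open>b\<close> shares an edge
  with \<open>a\<close>, and \<open>c\<close> with \<open>a\<close> or \<open>b\<close>.

  Given \<open>a\<close> and \<open>b\<close>, the expected number of such \<open>c\<close> is \<open>O(1 + S)\<close> for \<open>S = \<parallel>\<mu>\<parallel>\<^sub>2\<^sup>2\<close>: at most \<open>2\<^sup>4\<close>
  of them have no new vertex, and a new vertex \<open>w\<close> contributes \<open>O(\<mu>\<^sub>w\<^sup>2)\<close>. The remaining sum over
  \<open>a, b\<close> is at most \<open>2 \<sigma>\<^sup>2\<close>, because edges have probability at most \<open>1 / 2\<close>. So \<open>\<delta> = O((1 + S) / \<sigma>)\<close>,
  which is \<open>O(1 / \<surd>S)\<close> since \<open>\<sigma>\<^sup>2\<close> is at least of the order \<open>S\<^sup>3\<close> of the expected number of triangles.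
  Levy's continuity theorem concludes.
\<close>

subsection \<open>Stein's method for characteristic functions\<close>

lemma iexp_first_order: "cmod (iexp x - 1 - \<i> * x) \<le> x\<^sup>2 / 2"
  using iexp_approx1[of x 1] by (simp add: algebra_simps numeral_2_eq_2)

lemma iexp_zeroth_order: "cmod (iexp x - 1) \<le> \<bar>x\<bar>"
  using iexp_approx1[of x 0] by simp

text \<open>Finite support makes every function integrable and every expectation a finite sum, so no
  integrability side conditions remain below.\<close>

context
  fixes M :: "'w pmf"
  assumes finite_support: "finite (set_pmf M)"
begin

lemma integrable_finite_support [simp]:
  fixes f :: "'w \<Rightarrow> 'b::{banach, second_countable_topology}"
  shows "integrable (measure_pmf M) f"
  using finite_support by (rule integrable_measure_pmf_finite)

lemma norm_expectation_le:
  fixes f :: "'w \<Rightarrow> 'b::{banach, second_countable_topology}"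
  assumes "\<And>\<omega>. norm (f \<omega>) \<le> g \<omega>"
  shows "norm (LINT \<omega>|M. f \<omega>) \<le> (LINT \<omega>|M. g \<omega>)"
  by (rule order_trans[OF integral_norm_bound integral_mono]) (use assms in auto)

text \<open>One Tikhomirov step for a sum with dependency neighbourhoods \<open>N a\<close>. The
  hypotheses \<open>zero\<close> and \<open>indep\<close> are the only traces of independence:
  \<open>X a\<close> ignores what lies outside \<open>N a\<close>, and \<open>X a * X b\<close> what
  lies outside \<open>N a \<union> N b\<close>. When the double sum of covariances is the variance
  of \<open>W\<close>, the conclusion says that the characteristic function nearly satisfies the
  differential equation of a normal one.\<close>

lemma stein_char_bound:
  fixes X :: "'i \<Rightarrow> 'w \<Rightarrow> real" and N :: "'i \<Rightarrow> 'i set" and J :: "'i set" and t :: real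
  defines "W \<equiv> \<lambda>\<omega>. \<Sum>a\<in>J. X a \<omega>"
  assumes J: "finite J" and N: "\<And>a. a \<in> J \<Longrightarrow> N a \<subseteq> J"
    and zero: "\<And>a. a \<in> J \<Longrightarrow>
      (LINT \<omega>|M. complex_of_real (X a \<omega>) * iexp (t * (\<Sum>b\<in>J - N a. X b \<omega>))) = 0"
    and indep: "\<And>a b. a \<in> J \<Longrightarrow> b \<in> N a \<Longrightarrow>
      (LINT \<omega>|M. complex_of_real (X a \<omega> * X b \<omega>) * iexp (t * (\<Sum>c\<in>J - (N a \<union> N b). X c \<omega>))) =
      complex_of_real (LINT \<omega>|M. X a \<omega> * X b \<omega>) *
      (LINT \<omega>|M. iexp (t * (\<Sum>c\<in>J - (N a \<union> N b). X c \<omega>)))"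
  shows "cmod ((LINT \<omega>|M. complex_of_real (W \<omega>) * iexp (t * W \<omega>)) -
      \<i> * t * complex_of_real (\<Sum>a\<in>J. \<Sum>b\<in>N a. LINT \<omega>|M. X a \<omega> * X b \<omega>) * (LINT \<omega>|M. iexp (t * W \<omega>)))
    \<le> t\<^sup>2 * (\<Sum>a\<in>J. \<Sum>b\<in>N a. \<Sum>c\<in>N a \<union> N b.
        3 / 2 * (LINT \<omega>|M. \<bar>X a \<omega> * X b \<omega> * X c \<omega>\<bar>) +
        (LINT \<omega>|M. \<bar>X a \<omega> * X b \<omega>\<bar>) * (LINT \<omega>|M. \<bar>X c \<omega>\<bar>))"
proof -
  define D where "D S \<omega> = (\<Sum>b\<in>S. X b \<omega>)" for S \<omega>
  define \<phi> where "\<phi> = (LINT \<omega>|M. iexp (t * W \<omega>))"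
  have finN: "finite (N a)" if "a \<in> J" for a
    using J N that finite_subset by blast
  have split: "D (J - S) \<omega> = W \<omega> - D S \<omega>" if "S \<subseteq> J" for S \<omega>
    using that J unfolding D_def W_def by (simp add: sum_diff)
  \<comment> \<open>Removing the neighbours of \<open>a\<close> from the exponent gives a term with
    mean zero. Expanding this removal to first order around \<open>W\<close> leaves the linear term
    \<open>\<i> * t * X a * D (N a)\<close> and a quadratic remainder.\<close>
  have first: "cmod ((LINT \<omega>|M. complex_of_real (X a \<omega>) * iexp (t * W \<omega>)) -
      \<i> * t * (\<Sum>b\<in>N a. LINT \<omega>|M. complex_of_real (X a \<omega> * X b \<omega>) * iexp (t * W \<omega>)))
    \<le> t\<^sup>2 * (\<Sum>b\<in>N a. \<Sum>c\<in>N a. 1 / 2 * (LINT \<omega>|M. \<bar>X a \<omega> * X b \<omega> * X c \<omega>\<bar>))" (is "cmod ?L \<le> ?R")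
    if a: "a \<in> J" for a
  proof -
    let ?d = "\<lambda>\<omega>. D (N a) \<omega>"
    have "?L = (LINT \<omega>|M. complex_of_real (X a \<omega>) * iexp (t * W \<omega>)) -
        \<i> * t * (LINT \<omega>|M. complex_of_real (X a \<omega> * ?d \<omega>) * iexp (t * W \<omega>))"
      by (subst Bochner_Integration.integral_sum[symmetric])
        (simp_all add: D_def sum_distrib_left sum_distrib_right del: Bochner_Integration.integral_sum')
    also have "\<dots> = (LINT \<omega>|M. complex_of_real (X a \<omega>) * iexp (t * W \<omega>)) -
        \<i> * t * (LINT \<omega>|M. complex_of_real (X a \<omega> * ?d \<omega>) * iexp (t * W \<omega>)) -
        (LINT \<omega>|M. complex_of_real (X a \<omega>) * iexp (t * D (J - N a) \<omega>))"
      using zero[OF a] by (simp add: D_def)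
    also have "\<dots> = (LINT \<omega>|M. complex_of_real (X a \<omega>) * iexp (t * W \<omega>) -
        \<i> * t * (complex_of_real (X a \<omega> * ?d \<omega>) * iexp (t * W \<omega>)) -
        complex_of_real (X a \<omega>) * iexp (t * D (J - N a) \<omega>))"
      by (simp only: Bochner_Integration.integral_diff integral_mult_right_zero integrable_finite_support)
    also have "cmod \<dots> \<le> (LINT \<omega>|M. t\<^sup>2 / 2 * (\<Sum>b\<in>N a. \<Sum>c\<in>N a. \<bar>X a \<omega> * X b \<omega> * X c \<omega>\<bar>))"
    proof (rule norm_expectation_le)
      fix \<omega>
      have e: "iexp (t * D (J - N a) \<omega>) = iexp (t * W \<omega>) * iexp (- (t * ?d \<omega>))"
        by (simp add: split[OF N[OF a]] algebra_simps flip: exp_add)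
      have "cmod (complex_of_real (X a \<omega>) * iexp (t * W \<omega>) -
          \<i> * t * (complex_of_real (X a \<omega> * ?d \<omega>) * iexp (t * W \<omega>)) -
          complex_of_real (X a \<omega>) * iexp (t * D (J - N a) \<omega>)) =
          cmod (- complex_of_real (X a \<omega>) * iexp (t * W \<omega>) *
            (iexp (- (t * ?d \<omega>)) - 1 - \<i> * complex_of_real (- (t * ?d \<omega>))))"
        unfolding e by (rule arg_cong[where f = cmod]) (simp add: algebra_simps)
      also have "\<dots> = \<bar>X a \<omega>\<bar> * cmod (iexp (- (t * ?d \<omega>)) - 1 - \<i> * complex_of_real (- (t * ?d \<omega>)))"
        by (simp only: norm_mult norm_minus_cancel norm_of_real norm_exp_i_times mult_1_right)
      also have "\<dots> \<le> \<bar>X a \<omega>\<bar> * ((- (t * ?d \<omega>))\<^sup>2 / 2)"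
        by (intro mult_left_mono iexp_first_order) auto
      also have "\<dots> = t\<^sup>2 / 2 * \<bar>X a \<omega> * ?d \<omega> * ?d \<omega>\<bar>"
        by (simp add: power2_eq_square abs_mult)
      also have "\<bar>X a \<omega> * ?d \<omega> * ?d \<omega>\<bar> = \<bar>\<Sum>b\<in>N a. \<Sum>c\<in>N a. X a \<omega> * X b \<omega> * X c \<omega>\<bar>"
        unfolding D_def mult.assoc sum_product by (simp only: sum_distrib_left)
      also have "\<dots> \<le> (\<Sum>b\<in>N a. \<Sum>c\<in>N a. \<bar>X a \<omega> * X b \<omega> * X c \<omega>\<bar>)"
        by (intro order_trans[OF sum_abs] sum_mono) simp
      finally show "cmod (complex_of_real (X a \<omega>) * iexp (t * W \<omega>) -
          \<i> * t * (complex_of_real (X a \<omega> * ?d \<omega>) * iexp (t * W \<omega>)) -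
          complex_of_real (X a \<omega>) * iexp (t * D (J - N a) \<omega>))
        \<le> t\<^sup>2 / 2 * (\<Sum>b\<in>N a. \<Sum>c\<in>N a. \<bar>X a \<omega> * X b \<omega> * X c \<omega>\<bar>)"
        by (simp add: mult_left_mono)
    qed
    also have "\<dots> = ?R"
      by (simp add: sum_distrib_left)
    finally show ?thesis .
  qed
  \<comment> \<open>Decoupling of the covariance: the exponent loses all neighbours of
    \<open>a\<close> and \<open>b\<close>, the expectation factorizes, and the exponent is restored
    to \<open>W\<close>. The two moves cost the two summands on the right.\<close>
  have second: "cmod ((LINT \<omega>|M. complex_of_real (X a \<omega> * X b \<omega>) * iexp (t * W \<omega>)) -
      complex_of_real (LINT \<omega>|M. X a \<omega> * X b \<omega>) * \<phi>) \<le> \<bar>t\<bar> *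
      (\<Sum>c\<in>N a \<union> N b. (LINT \<omega>|M. \<bar>X a \<omega> * X b \<omega> * X c \<omega>\<bar>) +
        (LINT \<omega>|M. \<bar>X a \<omega> * X b \<omega>\<bar>) * (LINT \<omega>|M. \<bar>X c \<omega>\<bar>))"
    if a: "a \<in> J" and b: "b \<in> N a" for a b
  proof -
    let ?S = "N a \<union> N b"
    let ?Y = "\<lambda>\<omega>. X a \<omega> * X b \<omega>"
    have S: "?S \<subseteq> J" using N a b by blast
    have close: "cmod (iexp (t * W \<omega>) - iexp (t * D (J - ?S) \<omega>)) \<le> \<bar>t\<bar> * (\<Sum>c\<in>?S. \<bar>X c \<omega>\<bar>)" for \<omega>
    proof -
      have "iexp (t * W \<omega>) - iexp (t * D (J - ?S) \<omega>) =
          iexp (t * D (J - ?S) \<omega>) * (iexp (t * D ?S \<omega>) - 1)"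
        by (simp add: split[OF S] algebra_simps flip: exp_add)
      also have "cmod \<dots> = cmod (iexp (t * D ?S \<omega>) - 1)"
        by (simp only: norm_mult norm_exp_i_times mult_1_left)
      also have "\<dots> \<le> \<bar>t * D ?S \<omega>\<bar>"
        by (rule iexp_zeroth_order)
      also have "\<dots> \<le> \<bar>t\<bar> * (\<Sum>c\<in>?S. \<bar>X c \<omega>\<bar>)"
        unfolding D_def abs_mult by (intro mult_left_mono sum_abs) auto
      finally show ?thesis .
    qed
    have 1: "cmod (LINT \<omega>|M. complex_of_real (?Y \<omega>) * (iexp (t * W \<omega>) - iexp (t * D (J - ?S) \<omega>)))
        \<le> (LINT \<omega>|M. \<bar>?Y \<omega>\<bar> * (\<bar>t\<bar> * (\<Sum>c\<in>?S. \<bar>X c \<omega>\<bar>)))"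
      by (rule norm_expectation_le)
        (auto simp add: norm_mult simp del: of_real_mult intro!: mult_left_mono close)
    have "(LINT \<omega>|M. \<bar>?Y \<omega>\<bar> * (\<bar>t\<bar> * (\<Sum>c\<in>?S. \<bar>X c \<omega>\<bar>))) =
        \<bar>t\<bar> * (LINT \<omega>|M. (\<Sum>c\<in>?S. \<bar>?Y \<omega> * X c \<omega>\<bar>))"
      by (subst integral_mult_right_zero[symmetric])
        (simp add: abs_mult sum_distrib_left algebra_simps)
    then have step1: "(LINT \<omega>|M. \<bar>?Y \<omega>\<bar> * (\<bar>t\<bar> * (\<Sum>c\<in>?S. \<bar>X c \<omega>\<bar>))) =
        \<bar>t\<bar> * (\<Sum>c\<in>?S. LINT \<omega>|M. \<bar>?Y \<omega> * X c \<omega>\<bar>)"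
      by simp
    have "cmod (\<phi> - (LINT \<omega>|M. iexp (t * D (J - ?S) \<omega>))) =
        cmod (LINT \<omega>|M. iexp (t * W \<omega>) - iexp (t * D (J - ?S) \<omega>))"
      unfolding \<phi>_def by simp
    also have "\<dots> \<le> (LINT \<omega>|M. \<bar>t\<bar> * (\<Sum>c\<in>?S. \<bar>X c \<omega>\<bar>))"
      by (rule norm_expectation_le[OF close])
    finally have 2: "cmod (\<phi> - (LINT \<omega>|M. iexp (t * D (J - ?S) \<omega>))) \<le>
        \<bar>t\<bar> * (\<Sum>c\<in>?S. LINT \<omega>|M. \<bar>X c \<omega>\<bar>)"
      by simp
    \<comment> \<open>By \<open>indep\<close>, the two terms with the shortened exponent
      cancel.\<close>
    have "(LINT \<omega>|M. complex_of_real (?Y \<omega>) * iexp (t * W \<omega>)) - complex_of_real (LINT \<omega>|M. ?Y \<omega>) * \<phi> =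
       (LINT \<omega>|M. complex_of_real (?Y \<omega>) * (iexp (t * W \<omega>) - iexp (t * D (J - ?S) \<omega>))) -
       complex_of_real (LINT \<omega>|M. ?Y \<omega>) * (\<phi> - (LINT \<omega>|M. iexp (t * D (J - ?S) \<omega>)))"
      using indep[OF a b] unfolding D_def by (simp add: right_diff_distrib del: of_real_mult)
    also have "cmod \<dots> \<le> \<bar>t\<bar> * (\<Sum>c\<in>?S. LINT \<omega>|M. \<bar>?Y \<omega> * X c \<omega>\<bar>) +
        (LINT \<omega>|M. \<bar>?Y \<omega>\<bar>) * (\<bar>t\<bar> * (\<Sum>c\<in>?S. LINT \<omega>|M. \<bar>X c \<omega>\<bar>))"
      using 1 2 unfolding step1
      by (intro order_trans[OF norm_triangle_ineq4] add_mono)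
        (auto simp: norm_mult simp del: of_real_mult intro!: mult_mono integral_abs_bound)
    also have "\<dots> = \<bar>t\<bar> * (\<Sum>c\<in>?S. (LINT \<omega>|M. \<bar>?Y \<omega> * X c \<omega>\<bar>) +
        (LINT \<omega>|M. \<bar>?Y \<omega>\<bar>) * (LINT \<omega>|M. \<bar>X c \<omega>\<bar>))"
      by (simp add: sum.distrib sum_distrib_left algebra_simps)
    finally show ?thesis .
  qed
  have W_int: "(LINT \<omega>|M. complex_of_real (W \<omega>) * iexp (t * W \<omega>)) =
      (\<Sum>a\<in>J. LINT \<omega>|M. complex_of_real (X a \<omega>) * iexp (t * W \<omega>))"
    by (subst Bochner_Integration.integral_sum[symmetric]) (simp_all add: W_def sum_distrib_right)
  let ?T = "\<lambda>a. (LINT \<omega>|M. complex_of_real (X a \<omega>) * iexp (t * W \<omega>))"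
  let ?U = "\<lambda>a b. LINT \<omega>|M. complex_of_real (X a \<omega> * X b \<omega>) * iexp (t * W \<omega>)"
  let ?v = "\<lambda>a b. complex_of_real (LINT \<omega>|M. X a \<omega> * X b \<omega>)"
  have combine: "(\<Sum>a\<in>J. t\<^sup>2 * (\<Sum>b\<in>N a. P a b) + \<bar>t\<bar> * (\<Sum>b\<in>N a. \<bar>t\<bar> * Q a b)) =
      t\<^sup>2 * (\<Sum>a\<in>J. \<Sum>b\<in>N a. P a b + Q a b)" for P Q :: "'i \<Rightarrow> 'i \<Rightarrow> real"
  proof -
    have "\<bar>t\<bar> * (\<Sum>b\<in>N a. \<bar>t\<bar> * Q a b) = t\<^sup>2 * (\<Sum>b\<in>N a. Q a b)" for a
      by (simp add: sum_distrib_left power2_eq_square flip: mult.assoc)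
    then show ?thesis
      by (simp add: sum.distrib sum_distrib_left distrib_left)
  qed
  have decomp: "(LINT \<omega>|M. complex_of_real (W \<omega>) * iexp (t * W \<omega>)) -
      \<i> * t * complex_of_real (\<Sum>a\<in>J. \<Sum>b\<in>N a. LINT \<omega>|M. X a \<omega> * X b \<omega>) * \<phi>
    = (\<Sum>a\<in>J. (?T a - \<i> * t * (\<Sum>b\<in>N a. ?U a b)) + \<i> * t * (\<Sum>b\<in>N a. ?U a b - ?v a b * \<phi>))"
    unfolding W_int by (simp add: algebra_simps sum.distrib sum_subtractf sum_distrib_left del: of_real_mult)
  have "cmod ((LINT \<omega>|M. complex_of_real (W \<omega>) * iexp (t * W \<omega>)) -
      \<i> * t * complex_of_real (\<Sum>a\<in>J. \<Sum>b\<in>N a. LINT \<omega>|M. X a \<omega> * X b \<omega>) * \<phi>)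
    \<le> (\<Sum>a\<in>J. t\<^sup>2 * (\<Sum>b\<in>N a. \<Sum>c\<in>N a. 1 / 2 * (LINT \<omega>|M. \<bar>X a \<omega> * X b \<omega> * X c \<omega>\<bar>)) +
      \<bar>t\<bar> * (\<Sum>b\<in>N a. \<bar>t\<bar> *
      (\<Sum>c\<in>N a \<union> N b. (LINT \<omega>|M. \<bar>X a \<omega> * X b \<omega> * X c \<omega>\<bar>) +
        (LINT \<omega>|M. \<bar>X a \<omega> * X b \<omega>\<bar>) * (LINT \<omega>|M. \<bar>X c \<omega>\<bar>))))"
    unfolding decomp
  proof (rule sum_norm_le)
    fix a assume a: "a \<in> J"
    have "cmod (\<i> * t * (\<Sum>b\<in>N a. ?U a b - ?v a b * \<phi>)) \<le> \<bar>t\<bar> * (\<Sum>b\<in>N a. \<bar>t\<bar> *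
      (\<Sum>c\<in>N a \<union> N b. (LINT \<omega>|M. \<bar>X a \<omega> * X b \<omega> * X c \<omega>\<bar>) +
        (LINT \<omega>|M. \<bar>X a \<omega> * X b \<omega>\<bar>) * (LINT \<omega>|M. \<bar>X c \<omega>\<bar>)))"
    proof -
      have "cmod (\<i> * t * (\<Sum>b\<in>N a. ?U a b - ?v a b * \<phi>)) = \<bar>t\<bar> * cmod (\<Sum>b\<in>N a. ?U a b - ?v a b * \<phi>)"
        by (simp only: norm_mult norm_ii norm_of_real mult_1_left)
      then show ?thesis
        by (simp only:) (intro mult_left_mono sum_norm_le second[OF a] abs_ge_zero)
    qed
    from add_mono[OF first[OF a] this]
    show "cmod ((?T a - \<i> * t * (\<Sum>b\<in>N a. ?U a b)) + \<i> * t * (\<Sum>b\<in>N a. ?U a b - ?v a b * \<phi>)) \<le>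
      t\<^sup>2 * (\<Sum>b\<in>N a. \<Sum>c\<in>N a. 1 / 2 * (LINT \<omega>|M. \<bar>X a \<omega> * X b \<omega> * X c \<omega>\<bar>)) +
      \<bar>t\<bar> * (\<Sum>b\<in>N a. \<bar>t\<bar> *
      (\<Sum>c\<in>N a \<union> N b. (LINT \<omega>|M. \<bar>X a \<omega> * X b \<omega> * X c \<omega>\<bar>) +
        (LINT \<omega>|M. \<bar>X a \<omega> * X b \<omega>\<bar>) * (LINT \<omega>|M. \<bar>X c \<omega>\<bar>)))"
      by (rule order_trans[OF norm_triangle_ineq])
  qed
  also have "\<dots> = t\<^sup>2 * (\<Sum>a\<in>J. \<Sum>b\<in>N a. (\<Sum>c\<in>N a. 1 / 2 * (LINT \<omega>|M. \<bar>X a \<omega> * X b \<omega> * X c \<omega>\<bar>)) +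
      (\<Sum>c\<in>N a \<union> N b. (LINT \<omega>|M. \<bar>X a \<omega> * X b \<omega> * X c \<omega>\<bar>) +
        (LINT \<omega>|M. \<bar>X a \<omega> * X b \<omega>\<bar>) * (LINT \<omega>|M. \<bar>X c \<omega>\<bar>)))"
    by (rule combine)
  \<comment> \<open>The first error is enlarged from \<open>N a\<close> to
    \<open>N a \<union> N b\<close>, so that both errors run over the same \<open>c\<close>; their
    weights 1/2 and 1 add up to 3/2.\<close>
  also have "\<dots> \<le> t\<^sup>2 * (\<Sum>a\<in>J. \<Sum>b\<in>N a. (\<Sum>c\<in>N a \<union> N b. 1 / 2 * (LINT \<omega>|M. \<bar>X a \<omega> * X b \<omega> * X c \<omega>\<bar>)) +
      (\<Sum>c\<in>N a \<union> N b. (LINT \<omega>|M. \<bar>X a \<omega> * X b \<omega> * X c \<omega>\<bar>) +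
        (LINT \<omega>|M. \<bar>X a \<omega> * X b \<omega>\<bar>) * (LINT \<omega>|M. \<bar>X c \<omega>\<bar>)))"
    using finN N by (intro mult_left_mono sum_mono add_mono sum_mono2) auto
  also have "\<dots> = t\<^sup>2 * (\<Sum>a\<in>J. \<Sum>b\<in>N a. \<Sum>c\<in>N a \<union> N b.
        3 / 2 * (LINT \<omega>|M. \<bar>X a \<omega> * X b \<omega> * X c \<omega>\<bar>) +
        (LINT \<omega>|M. \<bar>X a \<omega> * X b \<omega>\<bar>) * (LINT \<omega>|M. \<bar>X c \<omega>\<bar>))"
    by (simp add: sum.distrib[symmetric])
  finally show ?thesis unfolding \<phi>_def .
qed

text \<open>The product of \<open>\<phi> t\<close> with the integrating factor
  \<open>exp (t\<^sup>2 / 2)\<close> equals 1 at 0, and by \<open>bound\<close> its derivative is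
  small. The mean value inequality on the segment from 0 to \<open>t\<close> then applies.\<close>

lemma char_near_normal:
  fixes Y :: "'w \<Rightarrow> real"
  defines "\<phi> \<equiv> \<lambda>t. LINT \<omega>|M. iexp (t * Y \<omega>)"
  assumes bound: "\<And>t. cmod ((LINT \<omega>|M. complex_of_real (Y \<omega>) * iexp (t * Y \<omega>)) - \<i> * t * \<phi> t) \<le> t\<^sup>2 * \<delta>"
  shows "cmod (\<phi> t * exp (t\<^sup>2 / 2) - 1) \<le> \<bar>t\<bar> ^ 3 * exp (t\<^sup>2 / 2) * \<delta>"
proof -
  define \<psi> where "\<psi> t = (LINT \<omega>|M. complex_of_real (Y \<omega>) * iexp (t * Y \<omega>))" for t
  \<comment> \<open>Written as a finite sum, the expectation can be differentiated term by
    term.\<close>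
  have \<phi>_sum: "\<phi> t = (\<Sum>\<omega>\<in>set_pmf M. pmf M \<omega> *\<^sub>R iexp (t * Y \<omega>))" for t
    unfolding \<phi>_def by (rule integral_measure_pmf[OF finite_support])
  have \<psi>_sum: "\<psi> t = (\<Sum>\<omega>\<in>set_pmf M. pmf M \<omega> *\<^sub>R (complex_of_real (Y \<omega>) * iexp (t * Y \<omega>)))" for t
    unfolding \<psi>_def by (rule integral_measure_pmf[OF finite_support])
  have d\<phi>: "(\<phi> has_vector_derivative \<i> * \<psi> s) (at s within A)" for s A
  proof -
    have "((\<lambda>t. \<Sum>\<omega>\<in>set_pmf M. pmf M \<omega> *\<^sub>R iexp (t * Y \<omega>)) has_vector_derivative
       (\<Sum>\<omega>\<in>set_pmf M. pmf M \<omega> *\<^sub>R (\<i> * (complex_of_real (Y \<omega>) * iexp (s * Y \<omega>))))) (at s within A)"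
    proof (intro has_vector_derivative_sum)
      fix \<omega>
      have "((\<lambda>t. exp (t *\<^sub>R (\<i> * complex_of_real (Y \<omega>)))) has_vector_derivative
         exp (s *\<^sub>R (\<i> * complex_of_real (Y \<omega>))) * (\<i> * complex_of_real (Y \<omega>))) (at s within A)"
        by (rule exp_scaleR_has_vector_derivative_right)
      then have "((\<lambda>t. iexp (t * Y \<omega>)) has_vector_derivative \<i> * (complex_of_real (Y \<omega>) * iexp (s * Y \<omega>)))
          (at s within A)"
        by (simp add: scaleR_conv_of_real mult_ac)
      then show "((\<lambda>t. pmf M \<omega> *\<^sub>R iexp (t * Y \<omega>)) has_vector_derivative
          pmf M \<omega> *\<^sub>R (\<i> * (complex_of_real (Y \<omega>) * iexp (s * Y \<omega>)))) (at s within A)"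
        by (rule has_vector_derivative_scaleR[OF DERIV_const, of _ _ _ _ "pmf M \<omega>", simplified])
    qed
    then show ?thesis
      by (simp add: \<phi>_sum[abs_def] \<psi>_sum sum_distrib_left)
  qed
  define g where "g t = \<phi> t * complex_of_real (exp (t\<^sup>2 / 2))" for t
  have dg: "(g has_vector_derivative \<i> * (\<psi> s - \<i> * s * \<phi> s) * exp (s\<^sup>2 / 2)) (at s within A)" for s A
  proof -
    have "((\<lambda>t. complex_of_real (exp (t\<^sup>2 / 2))) has_vector_derivative complex_of_real (s * exp (s\<^sup>2 / 2)))
        (at s within A)"
      by (rule has_vector_derivative_of_real) (auto intro!: derivative_eq_intros)
    from has_vector_derivative_mult[OF d\<phi> this] show ?thesis
      unfolding g_def[abs_def] by (simp add: algebra_simps)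
  qed
  have "\<delta> \<ge> 0"
    using order_trans[OF norm_ge_zero bound[of 1]] by simp
  \<comment> \<open>\<open>closed_segment\<close> treats both signs of \<open>t\<close> at once. On
    it the derivative of \<open>g\<close> is largest in the bound at \<open>s = t\<close>, and the
    length of the segment supplies the third factor \<open>\<bar>t\<bar>\<close>.\<close>
  have "cmod (g t - g 0) \<le> (t\<^sup>2 * \<delta> * exp (t\<^sup>2 / 2)) * norm (t - 0)"
  proof (rule differentiable_bound[where S = "closed_segment 0 t" and f = g])
    fix s assume "s \<in> closed_segment 0 t"
    then have s2: "s\<^sup>2 \<le> t\<^sup>2"
      by (auto simp: closed_segment_eq_real_ivl abs_le_square_iff[symmetric] split: if_splits)
    show "(g has_derivative (\<lambda>h. h *\<^sub>R (\<i> * (\<psi> s - \<i> * s * \<phi> s) * exp (s\<^sup>2 / 2)))) (at s within closed_segment 0 t)"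
      using dg by (simp add: has_vector_derivative_def)
    have "cmod (\<i> * (\<psi> s - \<i> * s * \<phi> s) * exp (s\<^sup>2 / 2)) = cmod (\<psi> s - \<i> * s * \<phi> s) * exp (s\<^sup>2 / 2)"
      by (simp add: norm_mult flip: exp_of_real)
    also have "\<dots> \<le> (t\<^sup>2 * \<delta>) * exp (t\<^sup>2 / 2)"
      using bound[of s] mult_right_mono[OF s2 \<open>\<delta> \<ge> 0\<close>] s2 \<open>\<delta> \<ge> 0\<close> unfolding \<psi>_def
      by (intro mult_mono) auto
    finally show "onorm (\<lambda>h. h *\<^sub>R (\<i> * (\<psi> s - \<i> * s * \<phi> s) * exp (s\<^sup>2 / 2))) \<le> t\<^sup>2 * \<delta> * exp (t\<^sup>2 / 2)"
      by (intro onorm_bound) (use \<open>\<delta> \<ge> 0\<close> in \<open>auto simp: mult.commute intro: mult_left_mono\<close>)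
  qed auto
  also have "g 0 = 1"
    by (simp add: g_def \<phi>_def)
  finally show ?thesis
    by (simp add: g_def power3_eq_cube power2_eq_square mult_ac flip: exp_of_real)
qed

end

subsection \<open>Sums of monomials in independent Bernoulli variables\<close>

text \<open>Independent coordinates \<open>e \<in> E\<close> with success probabilities
  \<open>p e\<close>, and for each index \<open>a\<close> the event that all coordinates in
  \<open>A a\<close> succeed. The upper bound 1/2 keeps the covariance of overlapping events
  comparable to their joint probability.\<close>

locale bernoulli_monomials =
  fixes E :: "'e set" and p :: "'e \<Rightarrow> real" and J :: "'i set" and A :: "'i \<Rightarrow> 'e set"
  assumes finite_E: "finite E" and finite_J: "finite J"
    and p_bounds: "\<And>e. e \<in> E \<Longrightarrow> 0 \<le> p e \<and> p e \<le> 1 / 2"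
    and A_subset: "\<And>a. a \<in> J \<Longrightarrow> A a \<subseteq> E"
begin

definition M :: "('e \<Rightarrow> bool) pmf" where
  "M = Pi_pmf E False (\<lambda>e. bernoulli_pmf (p e))"

definition P :: "'e set \<Rightarrow> real" where
  "P S = (\<Prod>e\<in>S. p e)"

definition mon :: "'e set \<Rightarrow> ('e \<Rightarrow> bool) \<Rightarrow> real" where
  "mon S \<omega> = of_bool (\<forall>e\<in>S. \<omega> e)"

definition X :: "'i \<Rightarrow> ('e \<Rightarrow> bool) \<Rightarrow> real" where
  "X a \<omega> = mon (A a) \<omega> - P (A a)"

definition W :: "('e \<Rightarrow> bool) \<Rightarrow> real" where
  "W \<omega> = (\<Sum>a\<in>J. X a \<omega>)"

text \<open>An index \<open>a\<close> in \<open>J\<close> with nonempty \<open>A a\<close> is its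
  own neighbour, so variances are included in sums over \<open>N a\<close>.\<close>

definition N :: "'i \<Rightarrow> 'i set" where
  "N a = {b\<in>J. A a \<inter> A b \<noteq> {}}"

lemma finite_M: "finite (set_pmf M)"
  unfolding M_def using finite_E
  by (intro finite_subset[OF set_Pi_pmf_subset'] finite_PiE_dflt) auto

lemma integrable_M [simp]:
  fixes f :: "('e \<Rightarrow> bool) \<Rightarrow> 'b::{banach, second_countable_topology}"
  shows "integrable (measure_pmf M) f"
  using finite_M by simp

section \<open>Probabilities of monomials and independence\<close>

lemma finite_edges: "S \<subseteq> E \<Longrightarrow> finite S"
  using finite_E finite_subset by blast

lemma P_nonneg: "S \<subseteq> E \<Longrightarrow> 0 \<le> P S"
  unfolding P_def using p_bounds by (intro prod_nonneg) auto

lemma P_le_1: "S \<subseteq> E \<Longrightarrow> P S \<le> 1"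
  unfolding P_def using p_bounds by (intro prod_le_1) fastforce

text \<open>The factor \<open>P (T - S)\<close> acts as the conditional probability of
  \<open>T\<close> given \<open>S\<close>.\<close>

lemma P_Un_diff: "S \<subseteq> E \<Longrightarrow> T \<subseteq> E \<Longrightarrow> P (S \<union> T) = P S * P (T - S)"
  unfolding P_def by (subst prod.union_disjoint[symmetric]) (auto dest: finite_edges)

lemma P_antimono: "S \<subseteq> T \<Longrightarrow> T \<subseteq> E \<Longrightarrow> P T \<le> P S"
  using P_Un_diff[of S T] P_nonneg[of S] P_le_1[of "T - S"] mult_left_le[of "P (T - S)" "P S"]
  by (auto simp: Un_absorb1)

text \<open>Positive correlation: on the left, the factors of shared elements, which are at most 1,
  occur twice.\<close>

lemma P_mult_le: "S \<subseteq> E \<Longrightarrow> T \<subseteq> E \<Longrightarrow> P S * P T \<le> P (S \<union> T)"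
  unfolding P_Un_diff by (intro mult_left_mono P_antimono P_nonneg) auto

lemma mon_mult: "mon S \<omega> * mon T \<omega> = mon (S \<union> T) \<omega>"
  by (auto simp: mon_def)

lemma mon_nonneg: "0 \<le> mon S \<omega>"
  by (simp add: mon_def)

lemma mon_cong: "(\<And>e. e \<in> S \<Longrightarrow> \<omega> e = \<omega>' e) \<Longrightarrow> mon S \<omega> = mon S \<omega>'"
  by (simp add: mon_def)

lemma expectation_mon: "S \<subseteq> E \<Longrightarrow> (LINT \<omega>|M. mon S \<omega>) = P S"
proof -
  assume S: "S \<subseteq> E"
  have "mon S \<omega> = (\<Prod>e\<in>E. if e \<in> S then of_bool (\<omega> e) else 1)" for \<omega>
  proof -
    have "(\<Prod>e\<in>E. if e \<in> S then of_bool (\<omega> e) else 1) = (\<Prod>e\<in>S. of_bool (\<omega> e) :: real)"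
      using S finite_E by (simp add: prod.If_cases Int_absorb1)
    also have "\<dots> = mon S \<omega>"
      using finite_edges[OF S] by (simp add: mon_def)
    finally show ?thesis by simp
  qed
  then have "(LINT \<omega>|M. mon S \<omega>) = (LINT \<omega>|M. (\<Prod>e\<in>E. (\<lambda>e b. if e \<in> S then of_bool b else 1) e (\<omega> e)))"
    by simp
  also have "\<dots> = (\<Prod>e\<in>E. (LINT b|bernoulli_pmf (p e). (if e \<in> S then of_bool b else 1)))"
    unfolding M_def by (rule expectation_prod_Pi_pmf[OF finite_E]) (auto intro: integrable_measure_pmf_finite)
  also have "\<dots> = (\<Prod>e\<in>E. if e \<in> S then p e else 1)"
    by (intro prod.cong refl) (use p_bounds in fastforce)
  also have "\<dots> = P S"
    using S finite_E by (simp add: P_def prod.If_cases Int_absorb1)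
  finally show ?thesis .
qed

text \<open>The measure is the image of the product of its restrictions to \<open>S\<close> and to
  \<open>E - S\<close> under the map \<open>h\<close> that glues two configurations. After this
  change of variables \<open>f\<close> sees only the first component and \<open>g\<close> only the
  second.\<close>

lemma expectation_indep:
  fixes f g :: "('e \<Rightarrow> bool) \<Rightarrow> complex"
  assumes S: "S \<subseteq> E"
    and f: "\<And>\<omega> \<omega>'. (\<And>e. e \<in> S \<Longrightarrow> \<omega> e = \<omega>' e) \<Longrightarrow> f \<omega> = f \<omega>'"
    and g: "\<And>\<omega> \<omega>'. (\<And>e. e \<in> E - S \<Longrightarrow> \<omega> e = \<omega>' e) \<Longrightarrow> g \<omega> = g \<omega>'"
  shows "(LINT \<omega>|M. f \<omega> * g \<omega>) = (LINT \<omega>|M. f \<omega>) * (LINT \<omega>|M. g \<omega>)"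
proof -
  define Q where "Q S = Pi_pmf S False (\<lambda>e. bernoulli_pmf (p e))" for S
  define h :: "('e \<Rightarrow> bool) \<times> ('e \<Rightarrow> bool) \<Rightarrow> 'e \<Rightarrow> bool" where
    "h = (\<lambda>(x, y) e. if e \<in> S then x e else y e)"
  have fin: "finite S" "finite (E - S)"
    using S finite_E finite_edges by auto
  have finQ: "finite (set_pmf (Q S))" "finite (set_pmf (Q (E - S)))"
    unfolding Q_def using fin by (auto intro!: finite_subset[OF set_Pi_pmf_subset'] finite_PiE_dflt)
  have M: "M = map_pmf h (pair_pmf (Q S) (Q (E - S)))"
    using Pi_pmf_union[of S "E - S" False "\<lambda>e. bernoulli_pmf (p e)"] fin S
    by (simp add: M_def Q_def h_def Un_absorb1)
  have fh: "f (h z) = f (fst z)" and gh: "g (h z) = g (snd z)" for z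
    by (auto simp: h_def case_prod_beta intro: f g)
  have marg1: "(LINT \<omega>|M. f \<omega>) = (LINT x|Q S. f x)"
    and marg2: "(LINT \<omega>|M. g \<omega>) = (LINT y|Q (E - S). g y)"
    by (simp_all add: M fh gh)
  have "(LINT \<omega>|M. f \<omega> * g \<omega>) = (LINT z|pair_pmf (Q S) (Q (E - S)). f (fst z) * g (snd z))"
    by (simp add: M fh gh)
  also have "\<dots> = (\<Sum>z\<in>set_pmf (Q S) \<times> set_pmf (Q (E - S)).
      pmf (pair_pmf (Q S) (Q (E - S))) z *\<^sub>R (f (fst z) * g (snd z)))"
    using finQ by (intro integral_measure_pmf) auto
  also have "\<dots> = (\<Sum>x\<in>set_pmf (Q S). pmf (Q S) x *\<^sub>R f x) * (\<Sum>y\<in>set_pmf (Q (E - S)). pmf (Q (E - S)) y *\<^sub>R g y)"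
    unfolding sum_product sum.cartesian_product
    by (rule sum.cong) (auto simp: pmf_pair)
  also have "\<dots> = (LINT x|Q S. f x) * (LINT y|Q (E - S). g y)"
    by (simp only: integral_measure_pmf[OF finQ(1), of "Q S" f] integral_measure_pmf[OF finQ(2), of "Q (E - S)" g])
  finally show ?thesis by (simp only: marg1 marg2)
qed

section \<open>Covariances and the variance of the sum\<close>

lemma X_cong: "(\<And>e. e \<in> A a \<Longrightarrow> \<omega> e = \<omega>' e) \<Longrightarrow> X a \<omega> = X a \<omega>'"
  unfolding X_def using mon_cong by metis

lemma expectation_X: "a \<in> J \<Longrightarrow> (LINT \<omega>|M. X a \<omega>) = 0"
  by (simp add: X_def expectation_mon A_subset)

lemma N_subset: "N a \<subseteq> J"
  by (auto simp: N_def)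

lemma covariance:
  assumes "a \<in> J" "b \<in> J"
  shows "(LINT \<omega>|M. X a \<omega> * X b \<omega>) = P (A a \<union> A b) - P (A a) * P (A b)"
proof -
  have "(LINT \<omega>|M. X a \<omega> * X b \<omega>) =
      (LINT \<omega>|M. mon (A a \<union> A b) \<omega> - P (A b) * mon (A a) \<omega> - P (A a) * mon (A b) \<omega> + P (A a) * P (A b))"
    by (intro Bochner_Integration.integral_cong refl) (simp add: X_def algebra_simps flip: mon_mult)
  then show ?thesis
    using assms A_subset by (simp add: expectation_mon)
qed

lemma covariance_disjoint:
  assumes "a \<in> J" "b \<in> J" "b \<notin> N a"
  shows "(LINT \<omega>|M. X a \<omega> * X b \<omega>) = 0"
proof -
  have "A b - A a = A b" using assms by (auto simp: N_def)
  then show ?thesis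
    using assms A_subset by (simp add: covariance P_Un_diff)
qed

lemma second_moment_W: "(LINT \<omega>|M. (W \<omega>)\<^sup>2) = (\<Sum>a\<in>J. \<Sum>b\<in>N a. LINT \<omega>|M. X a \<omega> * X b \<omega>)"
proof -
  have "(LINT \<omega>|M. (W \<omega>)\<^sup>2) = (\<Sum>a\<in>J. \<Sum>b\<in>J. LINT \<omega>|M. X a \<omega> * X b \<omega>)"
    by (simp add: W_def power2_eq_square sum_product)
  also have "\<dots> = (\<Sum>a\<in>J. \<Sum>b\<in>N a. LINT \<omega>|M. X a \<omega> * X b \<omega>)"
    using finite_J N_subset covariance_disjoint
    by (intro sum.cong refl sum.mono_neutral_right) auto
  finally show ?thesis .
qed

text \<open>The covariance is \<open>P (A a \<union> A b) * (1 - P (A a \<inter> A b))\<close>, and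
  the intersection contains some \<open>e\<close> with \<open>p e \<le> 1 / 2\<close>.\<close>

lemma covariance_lower_bound:
  assumes a: "a \<in> J" and b: "b \<in> N a"
  shows "P (A a \<union> A b) \<le> 2 * (LINT \<omega>|M. X a \<omega> * X b \<omega>)"
proof -
  have bJ: "b \<in> J" using b N_subset by blast
  obtain e where e: "e \<in> A a" "e \<in> A b"
    using b by (auto simp: N_def)
  have sub: "A a \<subseteq> E" "A b \<subseteq> E" using a bJ A_subset by auto
  have "P (A a \<inter> A b) \<le> P {e}"
    using e sub by (intro P_antimono) auto
  also have "\<dots> \<le> 1 / 2"
    using p_bounds e sub by (auto simp: P_def)
  finally have half: "P (A a \<inter> A b) \<le> 1 / 2" .
  have "P (A a) * P (A b) = P (A a \<union> A b) * P (A a \<inter> A b)"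
    using prod.union_inter[OF finite_edges[OF sub(1)] finite_edges[OF sub(2)], of p] by (simp add: P_def)
  also have "\<dots> \<le> P (A a \<union> A b) * (1 / 2)"
    using half sub by (intro mult_left_mono P_nonneg) auto
  finally show ?thesis
    using covariance[OF a bJ] by simp
qed

text \<open>Used in two directions: to absorb the sum over pairs in the Stein error, and to bound
  the variance from below.\<close>

lemma sum_P_Un_le: "(\<Sum>a\<in>J. \<Sum>b\<in>N a. P (A a \<union> A b)) \<le> 2 * (LINT \<omega>|M. (W \<omega>)\<^sup>2)"
  unfolding second_moment_W sum_distrib_left
  by (intro sum_mono covariance_lower_bound)

section \<open>Absolute moments\<close>

lemma abs_X_le: "a \<in> J \<Longrightarrow> \<bar>X a \<omega>\<bar> \<le> mon (A a) \<omega> + P (A a)"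
  using mon_nonneg[of "A a" \<omega>] P_nonneg[OF A_subset, of a] by (simp add: X_def)

lemma abs_moment_1: "a \<in> J \<Longrightarrow> (LINT \<omega>|M. \<bar>X a \<omega>\<bar>) \<le> 2 * P (A a)"
proof -
  assume a: "a \<in> J"
  have "(LINT \<omega>|M. \<bar>X a \<omega>\<bar>) \<le> (LINT \<omega>|M. mon (A a) \<omega> + P (A a))"
    by (intro integral_mono abs_X_le a) auto
  also have "\<dots> = 2 * P (A a)"
    using A_subset[OF a] by (simp add: expectation_mon)
  finally show ?thesis .
qed

lemma abs_moment_2:
  assumes "a \<in> J" "b \<in> J"
  shows "(LINT \<omega>|M. \<bar>X a \<omega> * X b \<omega>\<bar>) \<le> 4 * P (A a \<union> A b)"
proof -
  note sub = assms[THEN A_subset]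
  have "(LINT \<omega>|M. \<bar>X a \<omega> * X b \<omega>\<bar>) \<le> (LINT \<omega>|M. (mon (A a) \<omega> + P (A a)) * (mon (A b) \<omega> + P (A b)))"
    unfolding abs_mult
    by (intro integral_mono mult_mono abs_X_le assms) (auto intro!: add_nonneg_nonneg mon_nonneg P_nonneg sub)
  also have "\<dots> = (LINT \<omega>|M. mon (A a \<union> A b) \<omega> + P (A b) * mon (A a) \<omega> + P (A a) * mon (A b) \<omega> + P (A a) * P (A b))"
    by (intro Bochner_Integration.integral_cong refl) (simp add: algebra_simps flip: mon_mult)
  also have "\<dots> = P (A a \<union> A b) + 3 * (P (A a) * P (A b))"
    using sub by (simp add: expectation_mon)
  finally show ?thesis
    using P_mult_le[OF sub] by simp
qed

text \<open>Bounding each factor by \<open>mon + P\<close> and expanding gives eight terms. By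
  positive correlation the expectation of each is at most \<open>P\<close> of the full
  union.\<close>

lemma abs_moment_3:
  assumes "a \<in> J" "b \<in> J" "c \<in> J"
  shows "(LINT \<omega>|M. \<bar>X a \<omega> * X b \<omega> * X c \<omega>\<bar>) \<le> 8 * P (A a \<union> A b \<union> A c)"
proof -
  note sub = assms[THEN A_subset]
  let ?a = "A a" and ?b = "A b" and ?c = "A c"
  let ?U = "?a \<union> ?b \<union> ?c"
  have "(LINT \<omega>|M. \<bar>X a \<omega> * X b \<omega> * X c \<omega>\<bar>) \<le>
      (LINT \<omega>|M. (mon ?a \<omega> + P ?a) * (mon ?b \<omega> + P ?b) * (mon ?c \<omega> + P ?c))"
    unfolding abs_mult
    by (intro integral_mono mult_mono abs_X_le assms)
      (auto intro!: add_nonneg_nonneg mult_nonneg_nonneg mon_nonneg P_nonneg sub)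
  also have "\<dots> = (LINT \<omega>|M. mon ?U \<omega> + P ?c * mon (?a \<union> ?b) \<omega> + P ?b * mon (?a \<union> ?c) \<omega> +
      P ?a * mon (?b \<union> ?c) \<omega> + P ?a * P ?b * mon ?c \<omega> + P ?a * P ?c * mon ?b \<omega> +
      P ?b * P ?c * mon ?a \<omega> + P ?a * P ?b * P ?c)"
    by (intro Bochner_Integration.integral_cong refl) (simp add: algebra_simps flip: mon_mult)
  also have "\<dots> = P ?U + P ?c * P (?a \<union> ?b) + P ?b * P (?a \<union> ?c) + P ?a * P (?b \<union> ?c) +
      4 * (P ?a * P ?b * P ?c)"
    using sub by (simp add: expectation_mon)
  also have "P ?c * P (?a \<union> ?b) \<le> P ?U"
    using P_mult_le[of ?c "?a \<union> ?b"] sub by (simp add: Un_ac)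
  also have "P ?b * P (?a \<union> ?c) \<le> P ?U"
    using P_mult_le[of ?b "?a \<union> ?c"] sub by (simp add: Un_ac)
  also have "P ?a * P (?b \<union> ?c) \<le> P ?U"
    using P_mult_le[of ?a "?b \<union> ?c"] sub by (simp add: Un_ac)
  also have "P ?a * P ?b * P ?c \<le> P (?a \<union> ?b) * P ?c"
    using sub by (intro mult_right_mono P_mult_le P_nonneg)
  also have "P (?a \<union> ?b) * P ?c \<le> P ?U"
    using sub by (intro P_mult_le) auto
  finally show ?thesis by simp
qed

section \<open>Normal approximation for sums of centred monomials\<close>

text \<open>\<open>K\<close> bounds the expected number of neighbours \<open>c\<close> that are
  present, given that \<open>a\<close> and \<open>b\<close> are. The Stein error is thus at most 20
  \<open>K\<close> times the sum over pairs, which is at most twice the variance; this is the origin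
  of 40.\<close>

lemma char_bound:
  assumes K: "\<And>a b. a \<in> J \<Longrightarrow> b \<in> N a \<Longrightarrow> (\<Sum>c\<in>N a \<union> N b. P (A c - (A a \<union> A b))) \<le> K"
    and \<sigma>: "\<sigma> > 0" "(LINT \<omega>|M. (W \<omega>)\<^sup>2) = \<sigma>\<^sup>2"
  shows "cmod ((LINT \<omega>|M. iexp (t * (W \<omega> / \<sigma>))) * exp (t\<^sup>2 / 2) - 1) \<le>
    \<bar>t\<bar> ^ 3 * exp (t\<^sup>2 / 2) * (40 * K / \<sigma>)"
proof (rule char_near_normal[OF finite_M])
  fix t :: real
  define B where "B = (\<Sum>a\<in>J. \<Sum>b\<in>N a. \<Sum>c\<in>N a \<union> N b.
        3 / 2 * (LINT \<omega>|M. \<bar>X a \<omega> * X b \<omega> * X c \<omega>\<bar>) +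
        (LINT \<omega>|M. \<bar>X a \<omega> * X b \<omega>\<bar>) * (LINT \<omega>|M. \<bar>X c \<omega>\<bar>))"
  \<comment> \<open>20 is 3/2 * 8 from the third moment plus 4 * 2 from the product of the second
    and first moments.\<close>
  have "B \<le> (\<Sum>a\<in>J. \<Sum>b\<in>N a. \<Sum>c\<in>N a \<union> N b. 20 * P (A a \<union> A b \<union> A c))"
    unfolding B_def
  proof (intro sum_mono)
    fix a b c assume "a \<in> J" "b \<in> N a" "c \<in> N a \<union> N b"
    then have J: "a \<in> J" "b \<in> J" "c \<in> J" using N_subset by blast+
    note sub = J[THEN A_subset]
    have "(LINT \<omega>|M. \<bar>X a \<omega> * X b \<omega>\<bar>) * (LINT \<omega>|M. \<bar>X c \<omega>\<bar>) \<le> 4 * P (A a \<union> A b) * (2 * P (A c))"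
      using sub by (intro mult_mono abs_moment_1 abs_moment_2 J) (auto intro!: mult_nonneg_nonneg P_nonneg)
    also have "\<dots> \<le> 8 * P (A a \<union> A b \<union> A c)"
      using P_mult_le[of "A a \<union> A b" "A c"] sub by simp
    finally show "3 / 2 * (LINT \<omega>|M. \<bar>X a \<omega> * X b \<omega> * X c \<omega>\<bar>) +
        (LINT \<omega>|M. \<bar>X a \<omega> * X b \<omega>\<bar>) * (LINT \<omega>|M. \<bar>X c \<omega>\<bar>) \<le> 20 * P (A a \<union> A b \<union> A c)"
      using abs_moment_3[OF J] by simp
  qed
  also have "\<dots> = 20 * (\<Sum>a\<in>J. \<Sum>b\<in>N a. \<Sum>c\<in>N a \<union> N b. P (A a \<union> A b \<union> A c))"
    by (simp add: sum_distrib_left)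
  also have "(\<Sum>a\<in>J. \<Sum>b\<in>N a. \<Sum>c\<in>N a \<union> N b. P (A a \<union> A b \<union> A c)) \<le> (\<Sum>a\<in>J. \<Sum>b\<in>N a. P (A a \<union> A b) * K)"
  proof (intro sum_mono)
    fix a b assume ab: "a \<in> J" "b \<in> N a"
    then have sub: "A a \<union> A b \<subseteq> E" using N_subset A_subset by blast
    have "(\<Sum>c\<in>N a \<union> N b. P (A a \<union> A b \<union> A c)) = P (A a \<union> A b) * (\<Sum>c\<in>N a \<union> N b. P (A c - (A a \<union> A b)))"
      unfolding sum_distrib_left using N_subset A_subset sub
      by (intro sum.cong refl P_Un_diff) blast+
    also have "\<dots> \<le> P (A a \<union> A b) * K"
      using ab sub by (intro mult_left_mono K P_nonneg)
    finally show "(\<Sum>c\<in>N a \<union> N b. P (A a \<union> A b \<union> A c)) \<le> P (A a \<union> A b) * K" .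
  qed
  finally have B1: "B \<le> 20 * (K * (\<Sum>a\<in>J. \<Sum>b\<in>N a. P (A a \<union> A b)))"
    by (simp add: sum_distrib_left mult.commute)
  \<comment> \<open>The hypothesis on \<open>K\<close> is vacuous unless some neighbourhood is
    nonempty; the positive variance provides one.\<close>
  have "K \<ge> 0"
  proof -
    have "\<exists>a\<in>J. N a \<noteq> {}"
    proof (rule ccontr)
      assume "\<not> ?thesis"
      then have "(LINT \<omega>|M. (W \<omega>)\<^sup>2) = 0"
        unfolding second_moment_W by (intro sum.neutral) simp
      then show False using \<sigma> by simp
    qed
    then obtain a b where ab: "a \<in> J" "b \<in> N a" by blast
    have "0 \<le> (\<Sum>c\<in>N a \<union> N b. P (A c - (A a \<union> A b)))"
      using A_subset N_subset by (intro sum_nonneg P_nonneg) blast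
    also have "\<dots> \<le> K" by (rule K[OF ab])
    finally show ?thesis .
  qed
  then have B2: "B \<le> 40 * K * \<sigma>\<^sup>2"
    using mult_left_mono[OF sum_P_Un_le \<open>K \<ge> 0\<close>] B1 \<sigma>(2) by simp
  \<comment> \<open>The unnormalized sum is treated at the frequency \<open>s\<close>, where
    \<open>s\<^sup>2 * \<sigma>\<^sup>2 = t\<^sup>2\<close>; a final division by
    \<open>\<sigma>\<close> normalizes it.\<close>
  define s where "s = t / \<sigma>"
  have iexp_eq: "iexp (t * (W \<omega> / \<sigma>)) = iexp (s * W \<omega>)" for \<omega>
    by (simp add: s_def)
  have "cmod ((LINT \<omega>|M. complex_of_real (W \<omega>) * iexp (s * W \<omega>)) -
      \<i> * s * complex_of_real (\<sigma>\<^sup>2) * (LINT \<omega>|M. iexp (s * W \<omega>))) \<le> s\<^sup>2 * B"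
    unfolding \<sigma>(2)[symmetric] second_moment_W
    unfolding B_def W_def
  proof (rule stein_char_bound[OF finite_M finite_J N_subset])
    fix a assume a: "a \<in> J"
    have "(LINT \<omega>|M. complex_of_real (X a \<omega>) * iexp (s * (\<Sum>b\<in>J - N a. X b \<omega>))) =
      (LINT \<omega>|M. complex_of_real (X a \<omega>)) * (LINT \<omega>|M. iexp (s * (\<Sum>b\<in>J - N a. X b \<omega>)))"
    proof (rule expectation_indep[OF A_subset[OF a]])
      fix \<omega> \<omega>' :: "'e \<Rightarrow> bool" assume eq: "\<And>e. e \<in> E - A a \<Longrightarrow> \<omega> e = \<omega>' e"
      have "(\<Sum>b\<in>J - N a. X b \<omega>) = (\<Sum>b\<in>J - N a. X b \<omega>')"
        using A_subset by (intro sum.cong refl X_cong eq) (auto simp: N_def)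
      then show "iexp (s * (\<Sum>b\<in>J - N a. X b \<omega>)) = iexp (s * (\<Sum>b\<in>J - N a. X b \<omega>'))" by simp
    qed (use X_cong[of a] in metis)
    then show "(LINT \<omega>|M. complex_of_real (X a \<omega>) * iexp (s * (\<Sum>b\<in>J - N a. X b \<omega>))) = 0"
      using expectation_X[OF a] by simp
  next
    fix a b assume a: "a \<in> J" and b: "b \<in> N a"
    then have bJ: "b \<in> J" using N_subset by blast
    have "(LINT \<omega>|M. complex_of_real (X a \<omega> * X b \<omega>) * iexp (s * (\<Sum>c\<in>J - (N a \<union> N b). X c \<omega>))) =
      (LINT \<omega>|M. complex_of_real (X a \<omega> * X b \<omega>)) * (LINT \<omega>|M. iexp (s * (\<Sum>c\<in>J - (N a \<union> N b). X c \<omega>)))"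
    proof (rule expectation_indep[of "A a \<union> A b"])
      show "A a \<union> A b \<subseteq> E" using A_subset a bJ by blast
    next
      fix \<omega> \<omega>' :: "'e \<Rightarrow> bool" assume eq: "\<And>e. e \<in> A a \<union> A b \<Longrightarrow> \<omega> e = \<omega>' e"
      have "X a \<omega> = X a \<omega>'" "X b \<omega> = X b \<omega>'" by (intro X_cong eq; simp)+
      then show "complex_of_real (X a \<omega> * X b \<omega>) = complex_of_real (X a \<omega>' * X b \<omega>')" by simp
    next
      fix \<omega> \<omega>' :: "'e \<Rightarrow> bool" assume eq: "\<And>e. e \<in> E - (A a \<union> A b) \<Longrightarrow> \<omega> e = \<omega>' e"
      have "(\<Sum>c\<in>J - (N a \<union> N b). X c \<omega>) = (\<Sum>c\<in>J - (N a \<union> N b). X c \<omega>')"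
        using A_subset by (intro sum.cong refl X_cong eq) (auto simp: N_def)
      then show "iexp (s * (\<Sum>c\<in>J - (N a \<union> N b). X c \<omega>)) = iexp (s * (\<Sum>c\<in>J - (N a \<union> N b). X c \<omega>'))" by simp
    qed
    then show "(LINT \<omega>|M. complex_of_real (X a \<omega> * X b \<omega>) * iexp (s * (\<Sum>c\<in>J - (N a \<union> N b). X c \<omega>))) =
      complex_of_real (LINT \<omega>|M. X a \<omega> * X b \<omega>) * (LINT \<omega>|M. iexp (s * (\<Sum>c\<in>J - (N a \<union> N b). X c \<omega>)))"
      by (simp only: integral_complex_of_real)
  qed
  also have "\<dots> \<le> s\<^sup>2 * (40 * K * \<sigma>\<^sup>2)"
    by (intro mult_left_mono B2) simp
  finally have main: "cmod ((LINT \<omega>|M. complex_of_real (W \<omega>) * iexp (s * W \<omega>)) -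
      \<i> * s * complex_of_real (\<sigma>\<^sup>2) * (LINT \<omega>|M. iexp (s * W \<omega>))) \<le> t\<^sup>2 * (40 * K)"
    using \<sigma>(1) by (simp add: s_def power_divide)
  have "(LINT \<omega>|M. complex_of_real (W \<omega> / \<sigma>) * iexp (s * W \<omega>)) =
     (LINT \<omega>|M. complex_of_real (W \<omega>) * iexp (s * W \<omega>)) / \<sigma>"
    by simp
  moreover have "\<i> * t * (LINT \<omega>|M. iexp (s * W \<omega>)) =
      \<i> * s * complex_of_real (\<sigma>\<^sup>2) * (LINT \<omega>|M. iexp (s * W \<omega>)) / \<sigma>"
    using \<sigma>(1) by (simp add: s_def power2_eq_square)
  ultimately have "cmod ((LINT \<omega>|M. complex_of_real (W \<omega> / \<sigma>) * iexp (s * W \<omega>)) -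
      \<i> * t * (LINT \<omega>|M. iexp (s * W \<omega>))) = cmod (((LINT \<omega>|M. complex_of_real (W \<omega>) * iexp (s * W \<omega>)) -
      \<i> * s * complex_of_real (\<sigma>\<^sup>2) * (LINT \<omega>|M. iexp (s * W \<omega>))) / \<sigma>)"
    by (simp only: diff_divide_distrib)
  also have "\<dots> \<le> t\<^sup>2 * (40 * K) / \<sigma>"
    unfolding norm_divide using \<sigma>(1) main by (simp add: divide_right_mono)
  finally show "cmod ((LINT \<omega>|M. complex_of_real (W \<omega> / \<sigma>) * iexp (t * (W \<omega> / \<sigma>))) -
      \<i> * t * (LINT \<omega>|M. iexp (t * (W \<omega> / \<sigma>)))) \<le> t\<^sup>2 * (40 * K / \<sigma>)"
    unfolding iexp_eq by simp
qed

end

subsection \<open>Triangles\<close>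

text \<open>Pairs of a \<open>k\<close>-set and a further element are counted in two ways. The
  elements outside a given \<open>k\<close>-set have total weight at least
  \<open>sum x V - k * m\<close>, and each set of size \<open>k + 1\<close> arises from
  \<open>k + 1\<close> pairs.\<close>

lemma esymm_Suc_lower_bound:
  fixes x :: "'a \<Rightarrow> real"
  assumes V: "finite V" and x: "\<And>v. v \<in> V \<Longrightarrow> 0 \<le> x v \<and> x v \<le> m"
  shows "(sum x V - real k * m) * (\<Sum>s | s \<subseteq> V \<and> card s = k. \<Prod>v\<in>s. x v) \<le>
    real (Suc k) * (\<Sum>t | t \<subseteq> V \<and> card t = Suc k. \<Prod>v\<in>t. x v)"
proof -
  let ?C = "\<lambda>k. {s. s \<subseteq> V \<and> card s = k}"
  have finC: "finite (?C k)" for k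
    using V by simp
  have fin: "finite s" if "s \<in> ?C k" for s k
    using that V finite_subset by blast
  have "(sum x V - real k * m) * (\<Sum>s\<in>?C k. \<Prod>v\<in>s. x v) \<le> (\<Sum>s\<in>?C k. \<Sum>i\<in>V - s. x i * (\<Prod>v\<in>s. x v))"
    unfolding sum_distrib_left
  proof (rule sum_mono)
    fix s assume s: "s \<in> ?C k"
    then have "sum x s \<le> real k * m"
      using sum_bounded_above[of s x m] x by auto
    moreover have "sum x (V - s) = sum x V - sum x s"
      using s V by (simp add: sum_diff)
    moreover have "0 \<le> (\<Prod>v\<in>s. x v)"
      using s x by (intro prod_nonneg) auto
    ultimately have "(sum x V - real k * m) * (\<Prod>v\<in>s. x v) \<le> sum x (V - s) * (\<Prod>v\<in>s. x v)"
      by (intro mult_right_mono) auto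
    then show "(sum x V - real k * m) * (\<Prod>v\<in>s. x v) \<le> (\<Sum>i\<in>V - s. x i * (\<Prod>v\<in>s. x v))"
      by (simp add: sum_distrib_right)
  qed
  also have "\<dots> = (\<Sum>(s, i)\<in>Sigma (?C k) (\<lambda>s. V - s). x i * (\<Prod>v\<in>s. x v))"
    using finC V by (subst sum.Sigma) auto
  \<comment> \<open>A set with an outside element \<open>i\<close> corresponds to the enlarged set
    with \<open>i\<close> marked.\<close>
  also have "\<dots> = (\<Sum>(t, i)\<in>Sigma (?C (Suc k)) (\<lambda>t. t). \<Prod>v\<in>t. x v)"
  proof (rule sum.reindex_bij_witness[where i = "\<lambda>(t, i). (t - {i}, i)" and j = "\<lambda>(s, i). (insert i s, i)"])
    fix z assume z: "z \<in> Sigma (?C k) (\<lambda>s. V - s)"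
    then obtain s i where si: "z = (s, i)" "s \<subseteq> V" "card s = k" "i \<in> V" "i \<notin> s" by auto
    then have fins: "finite s" using V finite_subset by blast
    show "(case case z of (s, i) \<Rightarrow> (insert i s, i) of (t, i) \<Rightarrow> (t - {i}, i)) = z"
      using si by auto
    show "(case z of (s, i) \<Rightarrow> (insert i s, i)) \<in> Sigma (?C (Suc k)) (\<lambda>t. t)"
      using si fins by auto
    show "(case case z of (s, i) \<Rightarrow> (insert i s, i) of (t, i) \<Rightarrow> \<Prod>v\<in>t. x v) =
        (case z of (s, i) \<Rightarrow> x i * (\<Prod>v\<in>s. x v))"
      using si fins by auto
  next
    fix z assume z: "z \<in> Sigma (?C (Suc k)) (\<lambda>t. t)"
    then obtain t i where ti: "z = (t, i)" "t \<subseteq> V" "card t = Suc k" "i \<in> t" by auto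
    show "(case case z of (t, i) \<Rightarrow> (t - {i}, i) of (s, i) \<Rightarrow> (insert i s, i)) = z"
      using ti by (simp add: insert_absorb)
    show "(case z of (t, i) \<Rightarrow> (t - {i}, i)) \<in> Sigma (?C k) (\<lambda>s. V - s)"
      using ti by (simp add: subset_iff)
  qed
  also have "\<dots> = (\<Sum>t\<in>?C (Suc k). \<Sum>i\<in>t. \<Prod>v\<in>t. x v)"
    by (rule sum.Sigma[symmetric]) (use finC fin in blast)+
  also have "\<dots> = real (Suc k) * (\<Sum>t\<in>?C (Suc k). \<Prod>v\<in>t. x v)"
    unfolding sum_distrib_left by (intro sum.cong refl) simp
  finally show ?thesis .
qed

text \<open>Three extensions of the empty set give the product of \<open>?S\<close>,
  \<open>?S - 1\<close> and \<open>?S - 2\<close> as a lower bound for six times the third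
  polynomial. From \<open>?S \<ge> 4\<close>, the last two factors are at least
  \<open>?S / 2\<close>, whence 24 = 6 * 4.\<close>

lemma esymm_3_lower_bound:
  fixes x :: "'a \<Rightarrow> real"
  assumes V: "finite V" and x: "\<And>v. v \<in> V \<Longrightarrow> 0 \<le> x v \<and> x v \<le> 1" and S: "4 \<le> sum x V"
  shows "(sum x V) ^ 3 \<le> 24 * (\<Sum>t | t \<subseteq> V \<and> card t = 3. \<Prod>v\<in>t. x v)"
proof -
  let ?e = "\<lambda>k. (\<Sum>t | t \<subseteq> V \<and> card t = k. \<Prod>v\<in>t. x v)" and ?S = "sum x V"
  have "{t. t \<subseteq> V \<and> card t = 0} = {{}}"
    using V by (auto simp: finite_subset)
  then have e0: "?e 0 = 1" by simp
  have e1: "?S \<le> ?e 1"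
    using esymm_Suc_lower_bound[of V x 1 0, OF V x] e0 by simp
  have "(?S - 1) * ?e 1 \<le> 2 * ?e 2"
    using esymm_Suc_lower_bound[of V x 1 1, OF V x] by (simp add: numeral_2_eq_2)
  moreover have "(?S - 1) * ?S \<le> (?S - 1) * ?e 1"
    using S by (intro mult_left_mono e1) auto
  ultimately have e2: "(?S - 1) * ?S \<le> 2 * ?e 2" by linarith
  have "(?S - 2) * ?e 2 \<le> 3 * ?e 3"
    using esymm_Suc_lower_bound[of V x 1 2, OF V x] by (simp add: numeral_3_eq_3 numeral_2_eq_2)
  moreover have "(?S - 2) * ((?S - 1) * ?S) \<le> (?S - 2) * (2 * ?e 2)"
    using S by (intro mult_left_mono e2) auto
  ultimately have "(?S - 2) * ((?S - 1) * ?S) \<le> 6 * ?e 3" by linarith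
  moreover have "(?S / 2) * ((?S / 2) * ?S) \<le> (?S - 2) * ((?S - 1) * ?S)"
    using S by (intro mult_mono mult_right_mono) auto
  ultimately show ?thesis by (simp add: power3_eq_cube)
qed

section \<open>Triangles as three-element vertex sets\<close>

definition triangles :: "nat \<Rightarrow> nat set set" where
  "triangles n = {t. t \<subseteq> {1..n} \<and> card t = 3}"

definition edges :: "nat set \<Rightarrow> nat set set" where
  "edges t = {e. e \<subseteq> t \<and> card e = 2}"

lemma edges_triple:
  assumes "i \<noteq> j" "i \<noteq> k" "j \<noteq> k"
  shows "edges {i, j, k} = {{i, j}, {j, k}, {k, i}}"
proof
  show "edges {i, j, k} \<subseteq> {{i, j}, {j, k}, {k, i}}"
    unfolding edges_def using assms by (auto simp: card_2_iff doubleton_eq_iff)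
qed (use assms in \<open>auto simp: edges_def\<close>)

lemma triangles_cases:
  assumes "t \<in> triangles n"
  obtains i j k where "t = {i, j, k}" "i \<noteq> j" "i \<noteq> k" "j \<noteq> k" "i \<in> {1..n}" "j \<in> {1..n}" "k \<in> {1..n}"
  using assms unfolding triangles_def card_3_iff by auto

lemma finite_triangles [simp]: "finite (triangles n)"
  unfolding triangles_def by simp

text \<open>The inverse lists the elements of a three-element set in increasing order.\<close>

lemma sorted_triples_bij:
  "bij_betw (\<lambda>(i, j, k). {i, j, k}) (SIGMA i:{1..n}. SIGMA j:{i<..n}. {j<..n}) (triangles n)"
  unfolding bij_betw_def
proof
  show "inj_on (\<lambda>(i, j, k). {i, j, k}) (SIGMA i:{1..n}. SIGMA j:{i<..n}. {j<..n})"
  proof (rule inj_onI, clarsimp)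
    fix i j k i' j' k' :: nat
    assume lt: "i < j" "j < k" "i' < j'" "j' < k'" and eq: "{i, j, k} = {i', j', k'}"
    have "sorted_list_of_set {i, j, k} = [i, j, k]" "sorted_list_of_set {i', j', k'} = [i', j', k']"
      using lt by simp_all
    then have "[i, j, k] = [i', j', k']"
      using eq by metis
    then show "i = i' \<and> j = j' \<and> k = k'" by simp
  qed
  show "(\<lambda>(i, j, k). {i, j, k}) ` (SIGMA i:{1..n}. SIGMA j:{i<..n}. {j<..n}) = triangles n"
  proof
    show "(\<lambda>(i, j, k). {i, j, k}) ` (SIGMA i:{1..n}. SIGMA j:{i<..n}. {j<..n}) \<subseteq> triangles n"
    proof clarify
      fix i j k assume "i \<in> {1..n}" "j \<in> {i<..n}" "k \<in> {j<..n}"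
      then show "{i, j, k} \<in> triangles n"
        by (simp add: triangles_def)
    qed
    show "triangles n \<subseteq> (\<lambda>(i, j, k). {i, j, k}) ` (SIGMA i:{1..n}. SIGMA j:{i<..n}. {j<..n})"
    proof
      fix t assume t: "t \<in> triangles n"
      define xs where "xs = sorted_list_of_set t"
      have "finite t" "card t = 3" "t \<subseteq> {1..n}"
        using t finite_subset by (auto simp: triangles_def)
      then have xs: "length xs = 3" "set xs = t" "sorted_wrt (<) xs"
        by (simp_all add: xs_def)
      then obtain i j k where "xs = [i, j, k]"
        by (auto simp: numeral_3_eq_3 length_Suc_conv)
      then have "t = {i, j, k}" "i < j" "j < k" "i \<ge> 1" "k \<le> n"
        using xs \<open>t \<subseteq> {1..n}\<close> by auto
      then show "t \<in> (\<lambda>(i, j, k). {i, j, k}) ` (SIGMA i:{1..n}. SIGMA j:{i<..n}. {j<..n})"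
        by (intro image_eqI[of _ _ "(i, j, k)"]) auto
    qed
  qed
qed

lemma num_triangles_eq: "num_triangles n G = (\<Sum>t\<in>triangles n. of_bool (\<forall>e\<in>edges t. G e))"
proof -
  have "num_triangles n G =
      (\<Sum>(i, j, k)\<in>(SIGMA i:{1..n}. SIGMA j:{i<..n}. {j<..n}). edge_ind G i j * edge_ind G j k * edge_ind G k i)"
    unfolding num_triangles_def by (simp add: sum.Sigma split_def)
  also have "\<dots> = (\<Sum>z\<in>(SIGMA i:{1..n}. SIGMA j:{i<..n}. {j<..n}).
      of_bool (\<forall>e\<in>edges ((\<lambda>(i, j, k). {i, j, k}) z). G e))"
    by (intro sum.cong refl) (auto simp: edges_triple edge_ind_def)
  also have "\<dots> = (\<Sum>t\<in>triangles n. of_bool (\<forall>e\<in>edges t. G e))"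
    by (rule sum.reindex_bij_betw[OF sorted_triples_bij])
  finally show ?thesis .
qed

section \<open>The model with all parameters at most 1\<close>

locale sparse_beta_model =
  fixes n :: nat and \<mu> :: "nat \<Rightarrow> real"
  assumes \<mu>_bounds: "\<And>i. i \<in> {1..n} \<Longrightarrow> 0 < \<mu> i \<and> \<mu> i \<le> 1"
begin

lemma edge_prob_bounds:
  assumes "i \<in> {1..n}" "j \<in> {1..n}" "i \<noteq> j"
  shows "\<mu> i * \<mu> j / 2 \<le> edge_prob \<mu> {i, j}" "edge_prob \<mu> {i, j} \<le> \<mu> i * \<mu> j"
    "0 \<le> edge_prob \<mu> {i, j}" "edge_prob \<mu> {i, j} \<le> 1 / 2"
proof -
  \<comment> \<open>With odds \<open>q \<le> 1\<close>, the edge probability agrees with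
    \<open>q\<close> up to a factor 2.\<close>
  have odds: "q / 2 \<le> q / (1 + q)" "q / (1 + q) \<le> q" "0 \<le> q / (1 + q)" "q / (1 + q) \<le> 1 / 2"
    if "0 < q" "q \<le> 1" for q :: real
    using that by (auto simp: field_simps)
  have "0 < \<mu> i * \<mu> j" "\<mu> i * \<mu> j \<le> 1"
    using assms \<mu>_bounds[of i] \<mu>_bounds[of j] by (auto intro: mult_le_one)
  then show "\<mu> i * \<mu> j / 2 \<le> edge_prob \<mu> {i, j}" "edge_prob \<mu> {i, j} \<le> \<mu> i * \<mu> j"
    "0 \<le> edge_prob \<mu> {i, j}" "edge_prob \<mu> {i, j} \<le> 1 / 2"
    unfolding edge_prob_doubleton[OF assms(3)] by (simp_all only: odds)
qed

sublocale bernoulli_monomials "vertex_pairs n" "edge_prob \<mu>" "triangles n" edges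
proof
  show "finite (vertex_pairs n)" by (simp add: vertex_pairs_def)
  show "finite (triangles n)" by simp
  show "edges a \<subseteq> vertex_pairs n" if "a \<in> triangles n" for a
    using that by (auto simp: edges_def vertex_pairs_def triangles_def)
next
  fix e assume "e \<in> vertex_pairs n"
  then obtain i j where "e = {i, j}" "i \<noteq> j" "i \<in> {1..n}" "j \<in> {1..n}"
    by (auto simp: vertex_pairs_def card_2_iff)
  then show "0 \<le> edge_prob \<mu> e \<and> edge_prob \<mu> e \<le> 1 / 2"
    using edge_prob_bounds by blast
qed

definition S :: real where
  "S = (\<Sum>i=1..n. (\<mu> i)\<^sup>2)"

lemma M_eq: "M = beta_model n \<mu>"
  by (simp add: M_def beta_model_def)

lemma W_eq: "W G = num_triangles n G - (LINT G|M. num_triangles n G)"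
proof -
  have T: "num_triangles n G = (\<Sum>t\<in>triangles n. mon (edges t) G)" for G
    by (simp add: num_triangles_eq mon_def)
  have "(LINT G|M. num_triangles n G) = (\<Sum>t\<in>triangles n. P (edges t))"
    unfolding T using A_subset by (simp add: expectation_mon)
  then show ?thesis
    by (simp add: T W_def X_def sum_subtractf)
qed

lemma normalized_triangles_eq: "normalized_triangles n \<mu> G = W G / sqrt (LINT G|M. (W G)\<^sup>2)"
  unfolding normalized_triangles_def W_eq M_eq ..

lemma N_inter:
  assumes "a \<in> triangles n" "b \<in> N a"
  obtains e where "card e = 2" "e \<subseteq> a" "e \<subseteq> b"
  using assms by (auto simp: N_def edges_def)

text \<open>The edge shared by \<open>a\<close> and \<open>c\<close> avoids \<open>w\<close>, so it
  is the side of \<open>c\<close> opposite to \<open>w\<close>. The two sides at \<open>w\<close>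
  belong to neither \<open>a\<close> nor \<open>b\<close>, and each contributes a factor
  \<open>\<mu> w\<close>.\<close>

lemma P_new_triangle:
  assumes a: "a \<in> triangles n" and c: "c \<in> N a" and w: "w \<in> c" "w \<notin> a" "w \<notin> b"
  shows "c - {w} \<subseteq> a \<and> P (edges c - (edges a \<union> edges b)) \<le> (\<mu> w)\<^sup>2"
proof -
  obtain e where e: "card e = 2" "e \<subseteq> a" "e \<subseteq> c"
    using N_inter[OF a c] .
  have cT: "c \<in> triangles n" using c N_subset by blast
  then have c3: "card c = 3" "finite c" "c \<subseteq> {1..n}"
    using finite_subset by (auto simp: triangles_def)
  have "e \<subseteq> c - {w}" using e w by blast
  moreover have "card (c - {w}) = 2" using c3 w by simp
  ultimately have ce: "c - {w} = e"
    using e(1) c3 by (metis card_subset_eq finite_Diff)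
  then obtain x y where xy: "e = {x, y}" "x \<noteq> y"
    using e(1) by (auto simp: card_2_iff)
  have c_eq: "c = {x, y, w}" using ce xy w(1) by auto
  have ne: "x \<noteq> w" "y \<noteq> w" using ce xy by auto
  have V: "x \<in> {1..n}" "y \<in> {1..n}" "w \<in> {1..n}" using c3 c_eq by auto
  have "{{x, w}, {y, w}} \<subseteq> edges c - (edges a \<union> edges b)"
    using w ne unfolding c_eq by (auto simp: edges_def)
  then have "P (edges c - (edges a \<union> edges b)) \<le> P {{x, w}, {y, w}}"
    using A_subset[OF cT] by (intro P_antimono) auto
  also have "\<dots> = edge_prob \<mu> {x, w} * edge_prob \<mu> {y, w}"
    using xy ne by (simp add: P_def doubleton_eq_iff)
  also have "\<dots> \<le> (\<mu> x * \<mu> w) * (\<mu> y * \<mu> w)"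
    using V ne \<mu>_bounds[of x] \<mu>_bounds[of w] by (intro mult_mono edge_prob_bounds) auto
  also have "\<dots> = (\<mu> x * \<mu> y) * (\<mu> w)\<^sup>2"
    by (simp add: power2_eq_square)
  also have "\<dots> \<le> 1 * (\<mu> w)\<^sup>2"
    using \<mu>_bounds[OF V(1)] \<mu>_bounds[OF V(2)] by (intro mult_right_mono mult_le_one) auto
  finally show ?thesis using ce e by simp
qed

text \<open>Supplies the constant \<open>K\<close> of \<open>char_bound\<close>. Two triangles with
  a common edge span at most four vertices, hence at most 16 vertex subsets. Triangles inside this
  span contribute at most 16, those with a new vertex at most \<open>16 * S\<close>.\<close>

lemma sum_P_new_edges:
  assumes a: "a \<in> triangles n" and b: "b \<in> N a"
  shows "(\<Sum>c\<in>N a \<union> N b. P (edges c - (edges a \<union> edges b))) \<le> 16 * (1 + S)"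
proof -
  define U where "U = a \<union> b"
  let ?f = "\<lambda>c. P (edges c - (edges a \<union> edges b))"
  have bT: "b \<in> triangles n" using b N_subset by blast
  have a3: "card a = 3" "finite a" and b3: "card b = 3" "finite b"
    using a bT finite_subset by (auto simp: triangles_def)
  obtain e where e: "card e = 2" "e \<subseteq> a" "e \<subseteq> b"
    using N_inter[OF a b] .
  then have "2 \<le> card (a \<inter> b)"
    using card_mono[of "a \<inter> b" e] a3 by auto
  then have cardU: "card U \<le> 4" "finite U"
    using card_Un_Int[of a b] a3 b3 by (auto simp: U_def)
  have "(2::nat) ^ card U \<le> 2 ^ 4"
    by (intro power_increasing cardU) auto
  then have cardPow: "card (Pow U) \<le> 16"
    using cardU by (simp add: card_Pow)
  have finN: "finite (N a \<union> N b)"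
    using finite_subset[OF N_subset] by auto
  have sub: "edges c - (edges a \<union> edges b) \<subseteq> vertex_pairs n" if "c \<in> N a \<union> N b" for c
    using that N_subset A_subset by blast
  have old: "(\<Sum>c\<in>(N a \<union> N b) \<inter> Pow U. ?f c) \<le> 16"
  proof -
    have "(\<Sum>c\<in>(N a \<union> N b) \<inter> Pow U. ?f c) \<le> real (card ((N a \<union> N b) \<inter> Pow U)) * 1"
      by (intro sum_bounded_above P_le_1 sub) auto
    also have "card ((N a \<union> N b) \<inter> Pow U) \<le> card (Pow U)"
      using cardU by (intro card_mono) auto
    finally show ?thesis using cardPow by simp
  qed
  \<comment> \<open>Each such \<open>c\<close> is \<open>insert w s\<close> for a new vertex
    \<open>w\<close> and some \<open>s \<subseteq> U\<close>, so the sum is dominated by one over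
    all pairs \<open>(s, w)\<close>.\<close>
  have new: "(\<Sum>c\<in>(N a \<union> N b) - Pow U. ?f c) \<le> (\<Sum>z\<in>Pow U \<times> {1..n}. (\<mu> (snd z))\<^sup>2)"
  proof (rule sum_le_included[where i = "\<lambda>(s, w). insert w s"])
    show "\<forall>c\<in>(N a \<union> N b) - Pow U. \<exists>z\<in>Pow U \<times> {1..n}. (case z of (s, w) \<Rightarrow> insert w s) = c \<and> ?f c \<le> (\<mu> (snd z))\<^sup>2"
    proof
      fix c assume c: "c \<in> (N a \<union> N b) - Pow U"
      then obtain w where w: "w \<in> c" "w \<notin> a" "w \<notin> b" by (auto simp: U_def)
      have "c - {w} \<subseteq> U \<and> ?f c \<le> (\<mu> w)\<^sup>2"
        \<comment> \<open>\<open>c\<close> may neighbour \<open>a\<close> or \<open>b\<close>; in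
          the second case the two swap roles.\<close>
        using c P_new_triangle[OF a _ w, of] P_new_triangle[OF bT _ w(1,3,2)]
        by (auto simp: U_def Un_commute)
      moreover have "w \<in> {1..n}"
      proof -
        have "c \<in> triangles n" using c N_subset by blast
        then show ?thesis using w by (auto simp: triangles_def)
      qed
      ultimately show "\<exists>z\<in>Pow U \<times> {1..n}. (case z of (s, w) \<Rightarrow> insert w s) = c \<and> ?f c \<le> (\<mu> (snd z))\<^sup>2"
        using w by (intro bexI[of _ "(c - {w}, w)"]) auto
    qed
  qed (use finN cardU in auto)
  also have "\<dots> = real (card (Pow U)) * S"
    using sum.cartesian_product[of "\<lambda>s w. (\<mu> w)\<^sup>2" "{1..n}" "Pow U"]
    by (simp add: S_def split_def)
  also have "\<dots> \<le> 16 * S"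
    using cardPow by (intro mult_right_mono) (auto simp: S_def sum_nonneg)
  finally have "(\<Sum>c\<in>(N a \<union> N b) - Pow U. ?f c) \<le> 16 * S" .
  then show ?thesis
    using old sum.Int_Diff[OF finN, of ?f "Pow U"] by simp
qed

text \<open>Each vertex lies on two of the three edges, and each edge probability loses at most a
  factor 2.\<close>

lemma P_edges_lower_bound:
  assumes "t \<in> triangles n"
  shows "(\<Prod>v\<in>t. (\<mu> v)\<^sup>2) \<le> 8 * P (edges t)"
  using assms
proof (cases rule: triangles_cases)
  case (1 i j k)
  have "(\<mu> i * \<mu> j / 2) * (\<mu> j * \<mu> k / 2) * (\<mu> k * \<mu> i / 2) \<le>
      edge_prob \<mu> {i, j} * edge_prob \<mu> {j, k} * edge_prob \<mu> {k, i}"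
    using 1 \<mu>_bounds[of i] \<mu>_bounds[of j] \<mu>_bounds[of k]
    by (intro mult_mono edge_prob_bounds) (auto intro!: mult_nonneg_nonneg edge_prob_bounds)
  moreover have "P (edges t) = edge_prob \<mu> {i, j} * edge_prob \<mu> {j, k} * edge_prob \<mu> {k, i}"
    using 1 by (simp add: edges_triple P_def doubleton_eq_iff)
  moreover have "(\<Prod>v\<in>t. (\<mu> v)\<^sup>2) = 8 * ((\<mu> i * \<mu> j / 2) * (\<mu> j * \<mu> k / 2) * (\<mu> k * \<mu> i / 2))"
    using 1 by (simp add: power2_eq_square)
  ultimately show ?thesis by simp
qed

text \<open>The variance dominates half the expected number of triangles, which is comparable to the
  third elementary symmetric polynomial of the squares of the \<open>\<mu> v\<close>. The constant
  is 384 = 24 * 8 * 2.\<close>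

lemma variance_lower_bound:
  assumes "4 \<le> S"
  shows "S ^ 3 \<le> 384 * (LINT G|M. (W G)\<^sup>2)"
proof -
  have "S ^ 3 \<le> 24 * (\<Sum>t\<in>triangles n. \<Prod>v\<in>t. (\<mu> v)\<^sup>2)"
    unfolding S_def triangles_def
    by (rule esymm_3_lower_bound)
      (use \<mu>_bounds assms in \<open>auto simp: S_def power_le_one less_imp_le\<close>)
  also have "(\<Sum>t\<in>triangles n. \<Prod>v\<in>t. (\<mu> v)\<^sup>2) \<le> (\<Sum>t\<in>triangles n. 8 * P (edges t))"
    by (intro sum_mono P_edges_lower_bound)
  also have "(\<Sum>t\<in>triangles n. 8 * P (edges t)) = 8 * (\<Sum>t\<in>triangles n. P (edges t \<union> edges t))"
    by (simp add: sum_distrib_left)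
  \<comment> \<open>The left side consists of the diagonal terms \<open>b = t\<close> of the right
    side.\<close>
  also have "(\<Sum>t\<in>triangles n. P (edges t \<union> edges t)) \<le> (\<Sum>t\<in>triangles n. \<Sum>b\<in>N t. P (edges t \<union> edges b))"
  proof (rule sum_mono)
    fix t assume t: "t \<in> triangles n"
    have "edges t \<noteq> {}"
      using t by (cases rule: triangles_cases) (simp add: edges_triple)
    then have "t \<in> N t" using t by (simp add: N_def)
    moreover have "0 \<le> P (edges t \<union> edges b)" if "b \<in> N t" for b
    proof -
      have "b \<in> triangles n" using that N_subset by blast
      then show ?thesis using A_subset[OF t] A_subset[of b] by (intro P_nonneg) simp
    qed
    ultimately show "P (edges t \<union> edges t) \<le> (\<Sum>b\<in>N t. P (edges t \<union> edges b))"
      using finite_subset[OF N_subset finite_triangles]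
      by (intro member_le_sum[of t "N t" "\<lambda>b. P (edges t \<union> edges b)"]) auto
  qed
  also have "\<dots> \<le> 2 * (LINT G|M. (W G)\<^sup>2)"
    by (rule sum_P_Un_le)
  finally show ?thesis by simp
qed

lemma char_normalized_triangles:
  assumes S: "4 \<le> S"
  shows "cmod ((LINT G|beta_model n \<mu>. iexp (t * normalized_triangles n \<mu> G)) * exp (t\<^sup>2 / 2) - 1) \<le>
    \<bar>t\<bar> ^ 3 * exp (t\<^sup>2 / 2) * (25600 / sqrt S)"
proof -
  define \<sigma> where "\<sigma> = sqrt (LINT G|M. (W G)\<^sup>2)"
  have var: "S ^ 3 \<le> 384 * (LINT G|M. (W G)\<^sup>2)"
    by (rule variance_lower_bound[OF S])
  moreover have "0 < S ^ 3" using S by simp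
  ultimately have pos: "0 < (LINT G|M. (W G)\<^sup>2)" by linarith
  then have \<sigma>: "0 < \<sigma>" "(LINT G|M. (W G)\<^sup>2) = \<sigma>\<^sup>2"
    by (simp_all add: \<sigma>_def)
  have "(S * sqrt S)\<^sup>2 = S ^ 3"
    using S by (simp add: power_mult_distrib power2_eq_square power3_eq_cube)
  also have "\<dots> \<le> (20 * \<sigma>)\<^sup>2"
  proof -
    have "S ^ 3 \<le> 400 * \<sigma>\<^sup>2"
      using var zero_le_power2[of \<sigma>] unfolding \<sigma>(2) by linarith
    then show ?thesis by (simp add: power_mult_distrib)
  qed
  finally have "S * sqrt S \<le> 20 * \<sigma>"
    using \<sigma>(1) by (intro power2_le_imp_le[of "S * sqrt S"]) auto
  then have "S / \<sigma> \<le> 20 / sqrt S"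
    using S \<sigma>(1) by (simp add: field_simps)
  moreover have "40 * (16 * (1 + S)) / \<sigma> \<le> 1280 * (S / \<sigma>)"
    using S \<sigma>(1) by (simp add: field_simps)
  \<comment> \<open>\<open>1 + S \<le> 2 * S\<close> gives 1280 = 40 * 16 * 2; 384 was rounded up to
    the square of 20, and 25600 = 1280 * 20.\<close>
  ultimately have K: "40 * (16 * (1 + S)) / \<sigma> \<le> 25600 / sqrt S" by simp
  have "cmod ((LINT G|M. iexp (t * (W G / \<sigma>))) * exp (t\<^sup>2 / 2) - 1) \<le>
    \<bar>t\<bar> ^ 3 * exp (t\<^sup>2 / 2) * (40 * (16 * (1 + S)) / \<sigma>)"
    by (rule char_bound[OF sum_P_new_edges \<sigma>])
  also have "\<dots> \<le> \<bar>t\<bar> ^ 3 * exp (t\<^sup>2 / 2) * (25600 / sqrt S)"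
    by (intro mult_left_mono K) auto
  finally show ?thesis
    by (simp only: normalized_triangles_eq \<sigma>_def flip: M_eq)
qed

end

section \<open>Convergence in distribution\<close>

lemma lp_norm_2_eq: "lp_norm 2 n x = sqrt (\<Sum>i=1..n. (x i)\<^sup>2)"
  by (simp add: lp_norm_def powr_half_sqrt sum_nonneg)

theorem theorem2:
  fixes \<mu> :: "nat \<Rightarrow> nat \<Rightarrow> real"
  assumes "\<And>n i. n \<ge> 3 \<Longrightarrow> i \<in> {1..n} \<Longrightarrow> \<mu> n i > 0"
    and "(\<lambda>n. vec_max n (\<mu> n)) \<longlonglongrightarrow> 0"
    and "filterlim (\<lambda>n. lp_norm 2 n (\<mu> n)) at_top sequentially"
    and "(\<lambda>n. lp_norm (3/2) n (\<mu> n) powr (3/2)) \<in> O(\<lambda>n. lp_norm 2 n (\<mu> n) ^ 6) \<or>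
         (\<lambda>n. vec_max n (\<mu> n) / vec_min n (\<mu> n)) \<in> O(\<lambda>n. lp_norm 2 n (\<mu> n) powr (3/2))"
  shows "weak_conv_m
           (\<lambda>n. distr (measure_pmf (beta_model n (\<mu> n))) borel (normalized_triangles n (\<mu> n)))
           std_normal_distribution"
proof (rule levy_continuity)
  show "real_distribution (distr (measure_pmf (beta_model n (\<mu> n))) borel (normalized_triangles n (\<mu> n)))" for n
    by (rule prob_space.real_distribution_distr[OF measure_pmf.prob_space_axioms]) simp
  show "real_distribution std_normal_distribution"
    by (rule real_dist_normal_dist)
  fix t :: real
  let ?L = "\<lambda>n. lp_norm 2 n (\<mu> n)"
  define \<phi> where "\<phi> n = char (distr (measure_pmf (beta_model n (\<mu> n))) borel (normalized_triangles n (\<mu> n))) t" for n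
  have \<phi>_eq: "\<phi> n = (LINT G|beta_model n (\<mu> n). iexp (t * normalized_triangles n (\<mu> n) G))" for n
    unfolding \<phi>_def char_def by (subst integral_distr) auto
  have max_le: "\<forall>\<^sub>F n in sequentially. vec_max n (\<mu> n) < 1"
    using order_tendstoD(2)[OF assms(2)] by simp
  \<comment> \<open>The threshold 2 for the norm is the condition \<open>4 \<le> S\<close> of the
    quantitative bound.\<close>
  have L_ge: "\<forall>\<^sub>F n in sequentially. 2 \<le> ?L n"
    using assms(3) unfolding filterlim_at_top by blast
  \<comment> \<open>For fixed \<open>t\<close> the factor \<open>exp (t\<^sup>2 / 2)\<close> is a
    constant, so it can be divided out in the limit.\<close>
  have "(\<lambda>n. \<phi> n * exp (t\<^sup>2 / 2) - 1) \<longlonglongrightarrow> 0"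
  proof (rule Lim_null_comparison)
    show "\<forall>\<^sub>F n in sequentially. cmod (\<phi> n * exp (t\<^sup>2 / 2) - 1) \<le> \<bar>t\<bar> ^ 3 * exp (t\<^sup>2 / 2) * (25600 / ?L n)"
      using max_le L_ge eventually_ge_at_top[of 3]
    proof eventually_elim
      case (elim n)
      interpret sparse_beta_model n "\<mu> n"
      proof
        fix i assume i: "i \<in> {1..n}"
        then have "\<mu> n i \<le> vec_max n (\<mu> n)"
          unfolding vec_max_def by (intro Max_ge) auto
        then show "0 < \<mu> n i \<and> \<mu> n i \<le> 1"
          using assms(1)[OF elim(3) i] elim(1) by simp
      qed
      have L: "?L n = sqrt S" by (simp add: lp_norm_2_eq S_def)
      then have "4 \<le> S" using elim(2) real_le_rsqrt[of 2 S] power_mono[of 2 "sqrt S" 2]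
        by (cases "0 \<le> S") (auto simp: S_def sum_nonneg)
      from char_normalized_triangles[OF this, of t] show ?case
        by (simp only: \<phi>_eq L)
    qed
    show "(\<lambda>n. \<bar>t\<bar> ^ 3 * exp (t\<^sup>2 / 2) * (25600 / ?L n)) \<longlonglongrightarrow> 0"
      by (intro tendsto_mult_right_zero tendsto_divide_0[OF tendsto_const] filterlim_at_top_imp_at_infinity assms(3))
  qed
  then have "(\<lambda>n. \<phi> n * exp (t\<^sup>2 / 2)) \<longlonglongrightarrow> 1"
    using Lim_null by fastforce
  then have "(\<lambda>n. \<phi> n * exp (t\<^sup>2 / 2) * exp (- (t\<^sup>2) / 2)) \<longlonglongrightarrow> 1 * complex_of_real (exp (- (t\<^sup>2) / 2))"
    by (intro tendsto_mult_right)
  also have "(\<lambda>n. \<phi> n * exp (t\<^sup>2 / 2) * exp (- (t\<^sup>2) / 2)) = \<phi>"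
    by (simp add: mult.assoc flip: exp_of_real exp_add)
  finally show "(\<lambda>n. char (distr (measure_pmf (beta_model n (\<mu> n))) borel (normalized_triangles n (\<mu> n))) t)
      \<longlonglongrightarrow> char std_normal_distribution t"
    by (simp add: char_std_normal_distribution \<phi>_def[abs_def] flip: exp_of_real)
qed

end
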